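(* For every $\pi\in\mathscr{I}^{\pm}_{p,q}$, the $\mathcal{W}$-set of $\pi$ equals the set $\mathcal{A}(\pi)$ of permutations produced by the following algorithm. Let $\mathcal{M}$ be the signed matching of $\pi$; say a pair $a<b$ is nested inside a strand $\{c<d\}$ if $c<a<b<d$. Start with $A_0=[n]$. At step $i\ge1$, the values $w(1),\dots,w(i-1)$ and $w(n+2-i),\dots,w(n)$ have been determined and $A_{i-1}=[n]\setminus\{w(1),\dots,w(i-1),w(n+2-i),\dots,w(n)\}$. Choose either (1) a strand $\{a<b\}$ of $\mathcal{M}$ with $a,b\in A_{i-1}$ that is not nested inside any strand $\{c<d\}$ of $\mathcal{M}$ with $c,d\in A_{i-1}$, and set $w(i)=a$, $w(n+1-i)=b$; or (2) two isolated vertices $a<b$ of $\mathcal{M}$ of opposite signs which are adjacent in $A_{i-1}$ (no element of $A_{i-1}$ lies strictly between them) and are not nested inside any strand $\{c<d\}$ of $\mathcal{M}$ with $c,d\in A_{i-1}$, and set $w(i)=b$, $w(n+1-i)=a$. In either case put $A_i=A_{i-1}\setminus\{a,b\}$. Stop at the first $k$ for which $A_k$ consists only of isolated vertices of $\mathcal{M}$ all of the same sign, and fill the remaining undetermined middle positions of $w$ with the elements of $A_k$ in increasing order. $\mathcal{A}(\pi)$ is the set of all $w\in S_n$ obtained in this way for some sequence of choices.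
   Context: Fix $p\ge q>0$ with $p+q=n$. $\mathscr{I}^{\pm}_{p,q}$ is the set of involutions $\pi\in S_n$ together with an assignment of a sign $+$ or $-$ to each fixed point such that (number of $+$ fixed points) $-$ (number of $-$ fixed points) $=p-q$. Equivalently one uses signed matchings: a matching on vertices $1,\dots,n$ (strands $\{i<j\}$ for the two-cycles $(i,j)$, isolated vertices for the fixed points), with each isolated vertex carrying its sign. For an involution with $k$ two-cycles let $L(\pi)=(\ell(\pi)+k)/2$, $\ell$ the Coxeter length, and set $L^{\pm}(\pi)=pq-L(\pi)$. Covering relations $\mathcal{M}'\lessdot_i\mathcal{M}$ ($1\le i\le n-1$) between signed matchings, where in each case all other strands and signs are unchanged: (IA1) $\mathcal{M}'$ has $i$ isolated with sign $\varepsilon$ and a strand $\{k,i+1\}$ with $k<i$, and $\mathcal{M}$ has the strand $\{k,i\}$ and $i+1$ isolated with sign $\varepsilon$; (IA2) $\mathcal{M}'$ has a strand $\{i,k\}$ with $k>i+1$ and $i+1$ isolated with sign $\varepsilon$, and $\mathcal{M}$ has the strand $\{i+1,k\}$ and $i$ isolated with sign $\varepsilon$; (IB) $\mathcal{M}'$ has strands $\{k,i+1\}$ and $\{i,l\}$ with $k<i<i+1<l$, and $\mathcal{M}$ has strands $\{k,i\}$ and $\{i+1,l\}$; (IC1) $\mathcal{M}'$ has strands $\{i,l\}$ and $\{i+1,k\}$ with $i+1<k<l$, and $\mathcal{M}$ has strands $\{i,k\}$ and $\{i+1,l\}$; (IC2) $\mathcal{M}'$ has strands $\{k,i\}$ and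 $\{l,i+1\}$ with $l<k<i$, and $\mathcal{M}$ has strands $\{k,i+1\}$ and $\{l,i\}$; (II) $\mathcal{M}'$ has the strand $\{i,i+1\}$, and in $\mathcal{M}$ the vertices $i,i+1$ are isolated with opposite signs. The weak order on $\mathscr{I}^{\pm}_{p,q}$ is generated by these covers; its unique minimal element is $\alpha=(1,n)(2,n-1)\cdots(q,n+1-q)((q+1)^+)\cdots((n-q)^+)$. The $\mathcal{W}$-set of $\pi\in\mathscr{I}^{\pm}_{p,q}$ is the set of $w\in S_n$ with $\ell(w)=L^{\pm}(\pi)$ such that for some (equivalently any) reduced decomposition $w=s_{i_r}\cdots s_{i_2}s_{i_1}$ there are $\pi_1,\dots,\pi_{r-1}\in\mathscr{I}^{\pm}_{p,q}$ with $\alpha\lessdot_{i_1}\pi_1\lessdot_{i_2}\pi_2\cdots\lessdot_{i_r}\pi$. *)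

theory Defs
  imports "HOL-Combinatorics.Combinatorics"
begin

section \<open>Signed involutions and signed matchings\<close>

datatype sign = Plus | Minus

text \<open>
  A signed involution on \<open>[n]\<close> is a pair \<open>(\<pi>, \<sigma>)\<close>; the domain of the partial map \<open>\<sigma>\<close> is exactly the
  set of fixed points of \<open>\<pi>\<close> in \<open>[n]\<close>, so that equality of pairs is equality of signed involutions.
\<close>

type_synonym signed_invol = "(nat \<Rightarrow> nat) \<times> (nat \<rightharpoonup> sign)"

definition signed_involutions :: "nat \<Rightarrow> nat \<Rightarrow> signed_invol set" where
  "signed_involutions p q = {(\<pi>, \<sigma>).
     \<pi> permutes {1..p + q} \<and> \<pi> \<circ> \<pi> = id \<and>
     dom \<sigma> = {i \<in> {1..p + q}. \<pi> i = i} \<and>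
     int (card {i. \<sigma> i = Some Plus}) - int (card {i. \<sigma> i = Some Minus}) = int p - int q}"

text \<open>
  A strand joining \<open>i\<close> and \<open>j\<close> with \<open>i < j\<close> is represented by the ordered pair \<open>(i, j)\<close>; the isolated
  vertices are those in the domain of the sign map.
\<close>

type_synonym signed_matching = "(nat \<times> nat) set \<times> (nat \<rightharpoonup> sign)"

definition strands :: "(nat \<Rightarrow> nat) \<Rightarrow> (nat \<times> nat) set" where
  "strands \<pi> = {(i, j). i < j \<and> \<pi> i = j \<and> \<pi> j = i}"

fun matching_of :: "signed_invol \<Rightarrow> signed_matching" where
  "matching_of (\<pi>, \<sigma>) = (strands \<pi>, \<sigma>)"

text \<open>\<open>cover i M' M\<close> is the covering relation of \<open>M'\<close> by \<open>M\<close> with label \<open>i\<close>, where \<open>M\<close> is the larger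
  element.\<close>

inductive cover :: "nat \<Rightarrow> signed_matching \<Rightarrow> signed_matching \<Rightarrow> bool" for i :: nat where
  IA1: "\<lbrakk>k < i; \<sigma> i = Some \<epsilon>; (k, i + 1) \<in> S\<rbrakk> \<Longrightarrow>
    cover i (S, \<sigma>) (S - {(k, i + 1)} \<union> {(k, i)}, \<sigma>(i := None, i + 1 := Some \<epsilon>))"
| IA2: "\<lbrakk>i + 1 < k; (i, k) \<in> S; \<sigma> (i + 1) = Some \<epsilon>\<rbrakk> \<Longrightarrow>
    cover i (S, \<sigma>) (S - {(i, k)} \<union> {(i + 1, k)}, \<sigma>(i := Some \<epsilon>, i + 1 := None))"
| IB: "\<lbrakk>k < i; i + 1 < l; (k, i + 1) \<in> S; (i, l) \<in> S\<rbrakk> \<Longrightarrow>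
    cover i (S, \<sigma>) (S - {(k, i + 1), (i, l)} \<union> {(k, i), (i + 1, l)}, \<sigma>)"
| IC1: "\<lbrakk>i + 1 < k; k < l; (i, l) \<in> S; (i + 1, k) \<in> S\<rbrakk> \<Longrightarrow>
    cover i (S, \<sigma>) (S - {(i, l), (i + 1, k)} \<union> {(i, k), (i + 1, l)}, \<sigma>)"
| IC2: "\<lbrakk>l < k; k < i; (k, i) \<in> S; (l, i + 1) \<in> S\<rbrakk> \<Longrightarrow>
    cover i (S, \<sigma>) (S - {(k, i), (l, i + 1)} \<union> {(k, i + 1), (l, i)}, \<sigma>)"
| II: "\<lbrakk>(i, i + 1) \<in> S; \<epsilon> \<noteq> \<delta>\<rbrakk> \<Longrightarrow>
    cover i (S, \<sigma>) (S - {(i, i + 1)}, \<sigma>(i := Some \<epsilon>, i + 1 := Some \<delta>))"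

text \<open>The minimal element \<open>(1,n)(2,n-1)\<dots>(q,n+1-q)\<close> with all other points fixed and of sign \<open>+\<close>,
  where \<open>n = p + q\<close>.\<close>

definition min_elt :: "nat \<Rightarrow> nat \<Rightarrow> signed_invol" where
  "min_elt p q = (let n = p + q in
     (\<lambda>i. if i \<in> {1..q} \<union> {n + 1 - q..n} then n + 1 - i else i,
      \<lambda>i. if i \<in> {q + 1..n - q} then Some Plus else None))"


section \<open>Coxeter length\<close>

text \<open>The word \<open>[i\<^sub>1, \<dots>, i\<^sub>r]\<close> stands for the product \<open>s\<^bsub>i\<^sub>r\<^esub> \<cdots> s\<^bsub>i\<^sub>1\<^esub>\<close> of functions, so that
  \<open>s\<^bsub>i\<^sub>1\<^esub>\<close> is applied first.\<close>

definition word_perm :: "nat list \<Rightarrow> nat \<Rightarrow> nat" where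
  "word_perm is = fold (\<lambda>i w. transpose i (i + 1) \<circ> w) is id"

definition coxeter_length :: "nat \<Rightarrow> (nat \<Rightarrow> nat) \<Rightarrow> nat" where
  "coxeter_length n w =
     (LEAST r. \<exists>is. length is = r \<and> set is \<subseteq> {1..n - 1} \<and> word_perm is = w)"

definition reduced_word :: "nat \<Rightarrow> nat list \<Rightarrow> (nat \<Rightarrow> nat) \<Rightarrow> bool" where
  "reduced_word n is w \<longleftrightarrow>
     set is \<subseteq> {1..n - 1} \<and> word_perm is = w \<and> length is = coxeter_length n w"

definition L_invol :: "nat \<Rightarrow> (nat \<Rightarrow> nat) \<Rightarrow> rat" where
  "L_invol n \<pi> = (of_nat (coxeter_length n \<pi>) + of_nat (card (strands \<pi>))) / 2"

definition L_pm :: "nat \<Rightarrow> nat \<Rightarrow> signed_invol \<Rightarrow> rat" where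
  "L_pm p q x = of_nat (p * q) - L_invol (p + q) (fst x)"


section \<open>The W-set\<close>

definition saturated_chain ::
    "nat \<Rightarrow> nat \<Rightarrow> nat list \<Rightarrow> signed_invol \<Rightarrow> signed_invol \<Rightarrow> bool" where
  "saturated_chain p q is x y \<longleftrightarrow>
     (\<exists>c :: nat \<Rightarrow> signed_invol.
        c 0 = x \<and> c (length is) = y \<and>
        (\<forall>j \<le> length is. c j \<in> signed_involutions p q) \<and>
        (\<forall>j < length is. cover (is ! j) (matching_of (c j)) (matching_of (c (Suc j)))))"

definition W_set :: "nat \<Rightarrow> nat \<Rightarrow> signed_invol \<Rightarrow> (nat \<Rightarrow> nat) set" where
  "W_set p q x = {w. w permutes {1..p + q} \<and>
     of_nat (coxeter_length (p + q) w) = L_pm p q x \<and>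
     (\<exists>is. reduced_word (p + q) is w \<and> saturated_chain p q is (min_elt p q) x)}"


section \<open>The algorithm\<close>

definition nested_in :: "(nat \<times> nat) set \<Rightarrow> nat set \<Rightarrow> nat \<Rightarrow> nat \<Rightarrow> bool" where
  "nested_in S A a b \<longleftrightarrow>
     (\<exists>c d. (c, d) \<in> S \<and> c \<in> A \<and> d \<in> A \<and> c < a \<and> a < b \<and> b < d)"

definition monochromatic :: "(nat \<rightharpoonup> sign) \<Rightarrow> nat set \<Rightarrow> bool" where
  "monochromatic \<sigma> A \<longleftrightarrow> (\<exists>\<epsilon>. \<forall>a \<in> A. \<sigma> a = Some \<epsilon>)"

text \<open>
  \<open>alg_run n S \<sigma> w j A\<close> states that \<open>j\<close> steps of the algorithm can be carried out on the matching
  \<open>(S, \<sigma>)\<close>, without stopping before, such that the values determined in these steps are those of \<open>w\<close>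
  and the remaining set is \<open>A\<close>. The choice at step \<open>Suc j\<close> determines the values at the positions
  \<open>Suc j\<close> and \<open>n + 1 - Suc j\<close>.
\<close>

inductive alg_run ::
    "nat \<Rightarrow> (nat \<times> nat) set \<Rightarrow> (nat \<rightharpoonup> sign) \<Rightarrow> (nat \<Rightarrow> nat) \<Rightarrow> nat \<Rightarrow> nat set \<Rightarrow> bool"
  for n :: nat and S :: "(nat \<times> nat) set" and \<sigma> :: "nat \<rightharpoonup> sign" and w :: "nat \<Rightarrow> nat" where
  start: "alg_run n S \<sigma> w 0 {1..n}"
| strand: "\<lbrakk>alg_run n S \<sigma> w j A; \<not> monochromatic \<sigma> A;
    (a, b) \<in> S; a \<in> A; b \<in> A; \<not> nested_in S A a b;
    w (Suc j) = a; w (n + 1 - Suc j) = b\<rbrakk> \<Longrightarrow> alg_run n S \<sigma> w (Suc j) (A - {a, b})"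
| isolated: "\<lbrakk>alg_run n S \<sigma> w j A; \<not> monochromatic \<sigma> A;
    a \<in> A; b \<in> A; a < b; \<sigma> a = Some \<epsilon>; \<sigma> b = Some \<delta>; \<epsilon> \<noteq> \<delta>;
    \<not> (\<exists>x \<in> A. a < x \<and> x < b); \<not> nested_in S A a b;
    w (Suc j) = b; w (n + 1 - Suc j) = a\<rbrakk> \<Longrightarrow> alg_run n S \<sigma> w (Suc j) (A - {a, b})"

definition alg_set :: "nat \<Rightarrow> signed_invol \<Rightarrow> (nat \<Rightarrow> nat) set" where
  "alg_set n x = {w. w permutes {1..n} \<and>
     (\<exists>k A. alg_run n (strands (fst x)) (snd x) w k A \<and> monochromatic (snd x) A \<and>
        w ` {k + 1..n - k} = A \<and> strict_mono_on {k + 1..n - k} w)}"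

end

theory Submission
  imports Defs
begin

text \<open>
  A cover with label \<open>i\<close> starts from a matching whose involution has a descent at \<open>i\<close>. Unless
  \<open>{i, i + 1}\<close> is a strand, it conjugates by \<open>s\<^sub>i\<close>. On the other side, \<open>w\<close> is produced by the
  algorithm iff two conditions hold: \<open>w\<close> is \<^emph>\<open>admissible\<close>, a condition on the relative order of the
  values of \<open>w\<close> alone, and the matching is \<^emph>\<open>compatible\<close> with \<open>w\<close>, that is, it pairs the values at
  the mirror positions \<open>j\<close> and \<open>n + 1 - j\<close> for \<open>j \<le> q\<close>, as a strand if they are in increasing order
  and as isolated vertices of opposite sign otherwise. Passing from \<open>w\<close> to a longer \<open>s\<^sub>i w\<close> changes
  only the comparison of the values \<open>i\<close> and \<open>i + 1\<close>. Hence \<open>s\<^sub>i w\<close> is admissible iff \<open>w\<close> is and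
  the involution compatible with \<open>w\<close> has a descent at \<open>i\<close>, and induction on the length applies.
\<close>

section \<open>Inversions and Coxeter length\<close>

text \<open>The algorithm fills \<open>w\<close> from the outside in, while a cover multiplies
  \<open>w\<close> on the left and so exchanges two values at arbitrary positions; an induction on
  the steps of the algorithm cannot follow a chain. This is why the algorithm is first flattened
  into conditions on mirror positions that hold simultaneously. For that the number of steps must be
  known: a step removes either no sign or one of each kind, so the final monochromatic set keeps the
  sign surplus \<open>p - q\<close>. Hence it has exactly \<open>p - q\<close> elements, all of sign
  \<open>Plus\<close>, and there were exactly \<open>q\<close> steps. Once an increasing pair means
  a strand and a reversed pair means two isolated vertices, nesting and adjacency become
  inequalities between values of \<open>w\<close>, and the matching disappears from them. The
  induction on length lets \<open>x\<close> vary with \<open>w\<close> and may remove any descent of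
  \<open>w\<close>, so different reduced words never have to be compared. The length prescribed for
  elements of the W-set comes from the chain itself: every cover raises \<open>L_pm\<close> by one,
  starting from 0.\<close>

definition inversions :: "(nat \<Rightarrow> nat) \<Rightarrow> (nat \<times> nat) set" where
  "inversions w = {(a, b). a < b \<and> w b < w a}"

text \<open>Points outside \<open>{1..n}\<close> are fixed and so take part in no inversion; this is
  why \<open>inversions\<close> can range over all naturals without mentioning
  \<open>n\<close>.\<close>

lemma inversions_subset:
  assumes "w permutes {1..n}"
  shows "inversions w \<subseteq> {1..n} \<times> {1..n}"
proof -
  have out: "w x = x" if "x \<notin> {1..n}" for x
    using assms that by (rule permutes_not_in)
  have "in": "w x \<in> {1..n} \<longleftrightarrow> x \<in> {1..n}" for x
    using assms by (rule permutes_in_image)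
  have "a \<in> {1..n} \<and> b \<in> {1..n}" if "a < b" "w b < w a" for a b
    using that out[of a] out[of b] "in"[of a] "in"[of b] by (cases "a = 0"; cases "b \<le> n"; force)
  then show ?thesis
    by (auto simp: inversions_def)
qed

lemma finite_inversions: "w permutes {1..n} \<Longrightarrow> finite (inversions w)"
  by (rule finite_subset[OF inversions_subset]) auto

text \<open>Nothing lies strictly between \<open>i\<close> and \<open>Suc i\<close>, so exchanging
  them alters the order of no other pair. All statements about left multiplication by an adjacent
  transposition rest on this.\<close>

lemma transpose_Suc_less_iff:
  assumes "{x, y} \<noteq> {i, Suc i}"
  shows "transpose i (Suc i) x < transpose i (Suc i) y \<longleftrightarrow> x < y"
  using assms by (auto simp: transpose_def)

lemma inversions_transpose_comp:
  assumes w: "w permutes {1..n}" and uv: "u < v" "w u = i" "w v = Suc i"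
  shows "inversions (transpose i (Suc i) \<circ> w) = insert (u, v) (inversions w)"
    and "(u, v) \<notin> inversions w"
proof -
  have inj: "w a = w b \<longleftrightarrow> a = b" for a b
    using permutes_inj[OF w] by (auto dest: injD)
  have "(a, b) \<in> inversions (transpose i (Suc i) \<circ> w) \<longleftrightarrow> (a, b) \<in> insert (u, v) (inversions w)" for a b
  proof (cases "{w b, w a} = {i, Suc i}")
    case True
    then have "a = u \<and> b = v \<or> a = v \<and> b = u"
      using uv inj by (metis doubleton_eq_iff)
    then show ?thesis
      using uv by (auto simp: inversions_def)
  next
    case False
    then have "(a, b) \<noteq> (u, v)" using uv by auto
    then show ?thesis
      using transpose_Suc_less_iff[OF False] by (auto simp: inversions_def)
  qed
  then show "inversions (transpose i (Suc i) \<circ> w) = insert (u, v) (inversions w)"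
    by auto
  show "(u, v) \<notin> inversions w"
    using uv by (auto simp: inversions_def)
qed

lemma card_inversions_up:
  assumes w: "w permutes {1..n}" and "u < v" "w u = i" "w v = Suc i"
  shows "card (inversions (transpose i (Suc i) \<circ> w)) = Suc (card (inversions w))"
  using inversions_transpose_comp[OF assms] finite_inversions[OF w] by simp

lemma permutes_transpose_comp:
  assumes "w permutes {1..n}" "i \<in> {1..n - 1}"
  shows "transpose i (Suc i) \<circ> w permutes {1..n}"
proof (rule permutes_compose[OF assms(1)])
  show "transpose i (Suc i) permutes {1..n}"
    using assms(2) by (intro permutes_swap_id) auto
qed

lemma transpose_comp_transpose_comp: "transpose a b \<circ> (transpose a b \<circ> w) = w"
  by (auto simp: fun_eq_iff)

lemma card_inversions_down:
  assumes w: "w permutes {1..n}" and i: "i \<in> {1..n - 1}" and uv: "u < v" "w v = i" "w u = Suc i"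
  shows "card (inversions w) = Suc (card (inversions (transpose i (Suc i) \<circ> w)))"
  using card_inversions_up[OF permutes_transpose_comp[OF w i], of u v i] uv
  by (simp add: transpose_comp_transpose_comp)

text \<open>Descents here are left descents: they concern the positions of the values
  \<open>i\<close> and \<open>Suc i\<close>, since left multiplication acts on values.\<close>

lemma permutes_descent_cases:
  assumes w: "w permutes {1..n}" and i: "i \<in> {1..n - 1}"
  obtains (up) u v where "u \<in> {1..n}" "v \<in> {1..n}" "u < v" "w u = i" "w v = Suc i"
  | (down) u v where "u \<in> {1..n}" "v \<in> {1..n}" "u < v" "w v = i" "w u = Suc i"
proof -
  have "i \<in> {1..n}" "Suc i \<in> {1..n}"
    using i by auto
  then obtain a b where "a \<in> {1..n}" "w a = i" "b \<in> {1..n}" "w b = Suc i"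
    using permutes_image[OF w] by (metis imageE)
  moreover from this have "a \<noteq> b" by auto
  ultimately show thesis
    using that by (metis linorder_neqE_nat)
qed

lemma permutes_ex_descent:
  assumes w: "w permutes {1..n}" and "w \<noteq> id"
  shows "\<exists>i \<in> {1..n - 1}. \<exists>u v. u < v \<and> w v = i \<and> w u = Suc i"
proof (rule ccontr)
  assume nt: "\<not> ?thesis"
  let ?f = "inv w"
  have f: "?f permutes {1..n}"
    using w by (rule permutes_inv)
  have asc: "?f i < ?f (Suc i)" if i: "i \<in> {1..n - 1}" for i
    using w i
  proof (cases rule: permutes_descent_cases)
    case (up u v)
    then show ?thesis using permutes_inverses(2)[OF w] by metis
  next
    case (down u v)
    then show ?thesis using nt i by blast
  qed
  \<comment> \<open>Without a descent the inverse increases strictly on \<open>{1..n}\<close>, hence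
    never falls below the identity; only the identity permutation does that.\<close>
  have ge: "x \<le> ?f x" if "1 \<le> x" "x \<le> n" for x
    using that
  proof (induction x rule: dec_induct)
    case base
    then show ?case using permutes_in_image[OF f, of 1] by auto
  next
    case (step m)
    then have "m \<in> {1..n - 1}" "m \<le> ?f m" by auto
    with asc[of m] show ?case by linarith
  qed
  then have "?f = id"
    using f by (intro permutes_natset_ge) auto
  then have "w = id"
    using permutes_inv_inv[OF w] by (metis inv_id)
  with \<open>w \<noteq> id\<close> show False ..
qed

lemma inversions_id [simp]: "inversions id = {}"
  by (auto simp: inversions_def)

lemma word_perm_Nil [simp]: "word_perm [] = id"
  by (simp add: word_perm_def)

lemma word_perm_snoc: "word_perm (is @ [i]) = transpose i (Suc i) \<circ> word_perm is"
  unfolding word_perm_def by simp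

lemma word_perm_permutes: "set is \<subseteq> {1..n - 1} \<Longrightarrow> word_perm is permutes {1..n}"
proof (induction "is" rule: rev_induct)
  case Nil
  show ?case unfolding word_perm_Nil by (rule permutes_id)
next
  case (snoc i "is")
  then show ?case unfolding word_perm_snoc by (intro permutes_transpose_comp) auto
qed

lemma card_inversions_word_perm_le:
  "set is \<subseteq> {1..n - 1} \<Longrightarrow> card (inversions (word_perm is)) \<le> length is"
proof (induction "is" rule: rev_induct)
  case (snoc i "is")
  then have p: "word_perm is permutes {1..n}" and i: "i \<in> {1..n - 1}"
    by (simp_all del: One_nat_def add: word_perm_permutes)
  from p i show ?case
  proof (cases rule: permutes_descent_cases)
    case (up u v)
    from card_inversions_up[OF p this(3-5)] snoc show ?thesis by (simp del: comp_apply add: word_perm_snoc)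
  next
    case (down u v)
    from card_inversions_down[OF p i this(3-5)] snoc show ?thesis by (simp del: comp_apply add: word_perm_snoc)
  qed
qed simp

text \<open>Bubble sort: each letter removes one inversion, until the identity is reached.\<close>

lemma ex_word_perm:
  "w permutes {1..n} \<Longrightarrow>
    \<exists>is. length is = card (inversions w) \<and> set is \<subseteq> {1..n - 1} \<and> word_perm is = w"
proof (induction "card (inversions w)" arbitrary: w rule: less_induct)
  case less
  show ?case
  proof (cases "w = id")
    case True
    then show ?thesis by (intro exI[of _ "[]"]) simp
  next
    case False
    with less.prems obtain i u v where i: "i \<in> {1..n - 1}" and uv: "u < v" "w v = i" "w u = Suc i"
      using permutes_ex_descent by blast
    let ?w = "transpose i (Suc i) \<circ> w"
    have c: "card (inversions w) = Suc (card (inversions ?w))"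
      using card_inversions_down[OF less.prems i uv] .
    then obtain "is" where "length is = card (inversions ?w)" "set is \<subseteq> {1..n - 1}" "word_perm is = ?w"
      using less.hyps[of ?w] permutes_transpose_comp[OF less.prems i] by auto
    then show ?thesis
      using c i by (intro exI[of _ "is @ [i]"]) (simp add: word_perm_snoc transpose_comp_transpose_comp)
  qed
qed

lemma coxeter_length_eq_card_inversions:
  assumes "w permutes {1..n}"
  shows "coxeter_length n w = card (inversions w)"
  unfolding coxeter_length_def
proof (rule Least_equality)
  show "\<exists>is. length is = card (inversions w) \<and> set is \<subseteq> {1..n - 1} \<and> word_perm is = w"
    by (rule ex_word_perm[OF assms])
  show "card (inversions w) \<le> r"
    if "\<exists>is. length is = r \<and> set is \<subseteq> {1..n - 1} \<and> word_perm is = w" for r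
    using that card_inversions_word_perm_le by metis
qed

text \<open>Inversion exchanges positions and values, so the results on left multiplication carry
  over to right multiplication, as needed for conjugation.\<close>

lemma card_inversions_inv:
  assumes w: "w permutes {1..n}"
  shows "card (inversions (inv w)) = card (inversions w)"
proof -
  have "bij_betw (\<lambda>(a, b). (w b, w a)) (inversions w) (inversions (inv w))"
    using permutes_inverses[OF w]
    by (intro bij_betwI[where g = "\<lambda>(a, b). (inv w b, inv w a)"]) (auto simp: inversions_def)
  then show ?thesis
    by (metis bij_betw_same_card)
qed

section \<open>Covers as conjugations at descents\<close>

definition conj_adj :: "nat \<Rightarrow> (nat \<Rightarrow> nat) \<Rightarrow> nat \<Rightarrow> nat" where
  "conj_adj i \<pi> = transpose i (Suc i) \<circ> \<pi> \<circ> transpose i (Suc i)"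

lemma involution_eq_iff:
  assumes "\<And>a. \<pi> (\<pi> a) = a"
  shows "\<pi> a = b \<longleftrightarrow> \<pi> b = a"
  using assms by metis

lemma mem_strands_iff:
  assumes "\<And>a. \<pi> (\<pi> a) = a"
  shows "(a, b) \<in> strands \<pi> \<longleftrightarrow> a < b \<and> \<pi> a = b"
  using involution_eq_iff[OF assms] by (auto simp: strands_def)

lemma conj_adj_conj_adj [simp]: "conj_adj i (conj_adj i \<pi>) = \<pi>"
  by (auto simp: conj_adj_def fun_eq_iff)

lemma conj_adj_involution:
  assumes "\<And>a. \<pi> (\<pi> a) = a"
  shows "conj_adj i \<pi> (conj_adj i \<pi> a) = a"
  using assms by (simp add: conj_adj_def)

lemma strands_inject:
  assumes "\<And>a. \<pi> (\<pi> a) = a" "\<And>a. \<rho> (\<rho> a) = a" "strands \<pi> = strands \<rho>"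
  shows "\<pi> = \<rho>"
proof
  fix a
  note iff = mem_strands_iff[of \<pi>, OF assms(1)] mem_strands_iff[of \<rho>, OF assms(2)]
  have "a < b \<and> \<pi> a = b \<longleftrightarrow> a < b \<and> \<rho> a = b" for a b
    using iff assms(3) by metis
  then show "\<pi> a = \<rho> a"
    using assms(1,2) by (metis linorder_neqE_nat)
qed

lemma mem_strands_conj_adj:
  assumes "\<And>a. \<pi> (\<pi> a) = a"
  shows "(a, b) \<in> strands (conj_adj i \<pi>) \<longleftrightarrow>
    a < b \<and> \<pi> (transpose i (Suc i) a) = transpose i (Suc i) b"
  unfolding mem_strands_iff[of "conj_adj i \<pi>", OF conj_adj_involution[OF assms]]
  by (auto simp: conj_adj_def)

section \<open>The strand set after each type of covering move\<close>

context
  fixes \<pi> :: "nat \<Rightarrow> nat" and i :: nat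
  assumes inv: "\<And>a. \<pi> (\<pi> a) = a"
begin

lemma strands_conj_adj_IA1:
  assumes "k < i" "\<pi> i = i" "\<pi> (Suc i) = k"
  shows "strands (conj_adj i \<pi>) = strands \<pi> - {(k, i + 1)} \<union> {(k, i)}"
proof -
  have "\<pi> k = Suc i" using inv assms(3) by metis
  moreover have "\<pi> a \<noteq> i" if "a \<noteq> i" for a using inv assms(2) that by metis
  moreover have "\<pi> a \<noteq> Suc i" if "a \<noteq> k" for a using inv assms(3) that by metis
  ultimately have "(a, b) \<in> strands (conj_adj i \<pi>) \<longleftrightarrow> (a, b) \<in> strands \<pi> - {(k, i + 1)} \<union> {(k, i)}"
    for a b
    using assms by (auto simp: mem_strands_conj_adj[OF inv] mem_strands_iff[of \<pi>, OF inv] transpose_def)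
  then show ?thesis by (intro set_eqI) (simp only: split_paired_all)
qed

lemma strands_conj_adj_IA2:
  assumes "i + 1 < k" "\<pi> (Suc i) = Suc i" "\<pi> i = k"
  shows "strands (conj_adj i \<pi>) = strands \<pi> - {(i, k)} \<union> {(i + 1, k)}"
proof -
  have "\<pi> k = i" using inv assms(3) by metis
  moreover have "\<pi> a \<noteq> Suc i" if "a \<noteq> Suc i" for a using inv assms(2) that by metis
  moreover have "\<pi> a \<noteq> i" if "a \<noteq> k" for a using inv assms(3) that by metis
  ultimately have "(a, b) \<in> strands (conj_adj i \<pi>) \<longleftrightarrow> (a, b) \<in> strands \<pi> - {(i, k)} \<union> {(i + 1, k)}"
    for a b
    using assms by (auto simp: mem_strands_conj_adj[OF inv] mem_strands_iff[of \<pi>, OF inv] transpose_def)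
  then show ?thesis by (intro set_eqI) (simp only: split_paired_all)
qed

lemma strands_conj_adj_IB:
  assumes "k < i" "i + 1 < l" "\<pi> (Suc i) = k" "\<pi> i = l"
  shows "strands (conj_adj i \<pi>) = strands \<pi> - {(k, i + 1), (i, l)} \<union> {(k, i), (i + 1, l)}"
proof -
  have "\<pi> k = Suc i" "\<pi> l = i" using inv assms by metis+
  moreover have "\<pi> a \<noteq> Suc i" if "a \<noteq> k" for a using inv assms that by metis
  moreover have "\<pi> a \<noteq> i" if "a \<noteq> l" for a using inv assms that by metis
  ultimately have "(a, b) \<in> strands (conj_adj i \<pi>) \<longleftrightarrow> (a, b) \<in> strands \<pi> - {(k, i + 1), (i, l)} \<union> {(k, i), (i + 1, l)}"
    for a b
    using assms by (auto simp: mem_strands_conj_adj[OF inv] mem_strands_iff[of \<pi>, OF inv] transpose_def)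
  then show ?thesis by (intro set_eqI) (simp only: split_paired_all)
qed

lemma strands_conj_adj_IC1:
  assumes "i + 1 < k" "k < l" "\<pi> (Suc i) = k" "\<pi> i = l"
  shows "strands (conj_adj i \<pi>) = strands \<pi> - {(i, l), (i + 1, k)} \<union> {(i, k), (i + 1, l)}"
proof -
  have "\<pi> k = Suc i" "\<pi> l = i" using inv assms by metis+
  moreover have "\<pi> a \<noteq> Suc i" if "a \<noteq> k" for a using inv assms that by metis
  moreover have "\<pi> a \<noteq> i" if "a \<noteq> l" for a using inv assms that by metis
  ultimately have "(a, b) \<in> strands (conj_adj i \<pi>) \<longleftrightarrow> (a, b) \<in> strands \<pi> - {(i, l), (i + 1, k)} \<union> {(i, k), (i + 1, l)}"
    for a b
    using assms by (auto simp: mem_strands_conj_adj[OF inv] mem_strands_iff[of \<pi>, OF inv] transpose_def)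
  then show ?thesis by (intro set_eqI) (simp only: split_paired_all)
qed

lemma strands_conj_adj_IC2:
  assumes "l < k" "k < i" "\<pi> (Suc i) = l" "\<pi> i = k"
  shows "strands (conj_adj i \<pi>) = strands \<pi> - {(k, i), (l, i + 1)} \<union> {(k, i + 1), (l, i)}"
proof -
  have "\<pi> l = Suc i" "\<pi> k = i" using inv assms by metis+
  moreover have "\<pi> a \<noteq> Suc i" if "a \<noteq> l" for a using inv assms that by metis
  moreover have "\<pi> a \<noteq> i" if "a \<noteq> k" for a using inv assms that by metis
  ultimately have "(a, b) \<in> strands (conj_adj i \<pi>) \<longleftrightarrow> (a, b) \<in> strands \<pi> - {(k, i), (l, i + 1)} \<union> {(k, i + 1), (l, i)}"
    for a b
    using assms by (cases "a = i"; cases "a = Suc i"; cases "b = i"; cases "b = Suc i")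
      (auto simp: mem_strands_conj_adj[OF inv] mem_strands_iff[of \<pi>, OF inv])
  then show ?thesis by (intro set_eqI) (simp only: split_paired_all)
qed

lemma strands_fixed_II:
  assumes "\<pi> i = Suc i"
  shows "strands (\<pi>(i := i, Suc i := Suc i)) = strands \<pi> - {(i, i + 1)}"
proof -
  have "\<pi> (Suc i) = i" using inv assms by metis
  then have "\<pi> a \<noteq> i \<and> \<pi> a \<noteq> Suc i" if "a \<noteq> i" "a \<noteq> Suc i" for a
    using inv assms that by metis
  then have "(a, b) \<in> strands (\<pi>(i := i, Suc i := Suc i)) \<longleftrightarrow> (a, b) \<in> strands \<pi> - {(i, i + 1)}" for a b
    using assms \<open>\<pi> (Suc i) = i\<close> unfolding strands_def
    by (cases "a = i \<or> a = Suc i"; cases "b = i \<or> b = Suc i") auto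
  then show ?thesis by (intro set_eqI) (simp only: split_paired_all)
qed

end

text \<open>A relation rather than a function: the two free vertices can receive their opposite
  signs in two ways, so one element can have two type II covers with the same label.\<close>

definition unjoin_rel :: "nat \<Rightarrow> signed_invol \<Rightarrow> signed_invol \<Rightarrow> bool" where
  "unjoin_rel i x' x \<longleftrightarrow>
     fst x = (fst x')(i := i, Suc i := Suc i) \<and>
     (\<exists>\<epsilon> \<delta>. \<epsilon> \<noteq> \<delta> \<and> snd x = (snd x')(i := Some \<epsilon>, Suc i := Some \<delta>))"

definition conj_adj_signed :: "nat \<Rightarrow> signed_invol \<Rightarrow> signed_invol" where
  "conj_adj_signed i x = (conj_adj i (fst x), snd x \<circ> transpose i (Suc i))"

lemma signed_involutionsD:
  assumes "x \<in> signed_involutions p q"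
  shows "fst x permutes {1..p + q}" "fst x (fst x a) = a"
    "dom (snd x) = {i \<in> {1..p + q}. fst x i = i}"
    "int (card {i. snd x i = Some Plus}) - int (card {i. snd x i = Some Minus}) = int p - int q"
proof -
  obtain \<pi> \<sigma> where [simp]: "x = (\<pi>, \<sigma>)"
    by (metis surj_pair)
  have *: "\<pi> permutes {1..p + q}" "\<pi> \<circ> \<pi> = id" "dom \<sigma> = {i \<in> {1..p + q}. \<pi> i = i}"
    "int (card {i. \<sigma> i = Some Plus}) - int (card {i. \<sigma> i = Some Minus}) = int p - int q"
    using assms by (simp_all only: \<open>x = (\<pi>, \<sigma>)\<close> signed_involutions_def mem_Collect_eq prod.case)
  show "fst x permutes {1..p + q}" "dom (snd x) = {i \<in> {1..p + q}. fst x i = i}"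
    "int (card {i. snd x i = Some Plus}) - int (card {i. snd x i = Some Minus}) = int p - int q"
    using * by simp_all
  show "fst x (fst x a) = a"
    using fun_cong[OF *(2)] by simp
qed

text \<open>The five covers of types IA to IC are uniformly the conjugations by an adjacent transposition
  at a descent of the involution, and type II is the remaining kind of descent.\<close>

lemma cover_iff:
  assumes x': "x' \<in> signed_involutions p q" and x: "x \<in> signed_involutions p q"
    and i: "i \<in> {1..p + q - 1}"
  shows "cover i (matching_of x') (matching_of x) \<longleftrightarrow>
    fst x' (Suc i) < fst x' i \<and>
    (if fst x' i = Suc i then unjoin_rel i x' x else x = conj_adj_signed i x')"
proof -
  obtain \<pi>' \<sigma>' \<pi> \<sigma> where xs: "x' = (\<pi>', \<sigma>')" "x = (\<pi>, \<sigma>)"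
    by (metis surj_pair)
  note D' = signed_involutionsD[OF x', unfolded xs fst_conv snd_conv]
  note D = signed_involutionsD[OF x, unfolded xs fst_conv snd_conv]
  have in_n: "i \<in> {1..p + q}" "Suc i \<in> {1..p + q}" using i by auto
  have dom': "\<sigma>' a = None \<longleftrightarrow> \<pi>' a \<noteq> a" if "a \<in> {1..p + q}" for a
    using D'(3) that by (metis (mono_tags, lifting) domIff mem_Collect_eq)
  have mem': "(a, b) \<in> strands \<pi>' \<longleftrightarrow> a < b \<and> \<pi>' a = b" for a b
    by (rule mem_strands_iff) (rule D'(2))
  have eqI: "\<pi> = \<rho>" if "strands \<pi> = strands \<rho>" "\<And>a. \<rho> (\<rho> a) = a" for \<rho>
    using that D(2) by (intro strands_inject[of \<pi>]) auto
  note conj_eqI = eqI[OF _ conj_adj_involution[of \<pi>', OF D'(2)]]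
  \<comment> \<open>For types IB, IC1 and IC2 both vertices are unsigned and this update changes
    nothing, so one formula serves all five conjugation types.\<close>
  have sw: "\<sigma>' \<circ> transpose i (Suc i) = \<sigma>'(i := \<sigma>' (Suc i), Suc i := \<sigma>' i)"
    by (auto simp: fun_eq_iff transpose_def)
  have "\<pi>' (Suc i) < \<pi>' i \<and>
    (if \<pi>' i = Suc i then unjoin_rel i x' x else x = conj_adj_signed i x')"
    if "cover i (strands \<pi>', \<sigma>') (strands \<pi>, \<sigma>)"
    using that
  proof cases
    case (IA1 k \<epsilon>)
    have f: "\<pi>' i = i" "\<pi>' (Suc i) = k"
      using IA1 dom'[of i] in_n mem'[of k "Suc i"] D'(2)[of k] by auto
    have "\<pi> = conj_adj i \<pi>'"
      using IA1 f by (intro conj_eqI) (simp add: strands_conj_adj_IA1[of \<pi>', OF D'(2)])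
    moreover have "\<sigma> = \<sigma>' \<circ> transpose i (Suc i)"
      using IA1 f dom'[of "Suc i"] in_n by (simp add: sw)
    ultimately show ?thesis
      using IA1 f by (simp add: xs conj_adj_signed_def)
  next
    case (IA2 k \<epsilon>)
    have f: "\<pi>' (Suc i) = Suc i" "\<pi>' i = k"
      using IA2 dom'[of "Suc i"] in_n mem'[of i k] by auto
    have "\<pi> = conj_adj i \<pi>'"
      using IA2 f by (intro conj_eqI) (simp add: strands_conj_adj_IA2[of \<pi>', OF D'(2)])
    moreover have "\<sigma> = \<sigma>' \<circ> transpose i (Suc i)"
      using IA2 f dom'[of i] in_n by (simp add: sw)
    ultimately show ?thesis
      using IA2 f by (simp add: xs conj_adj_signed_def)
  next
    case (IB k l)
    have f: "\<pi>' (Suc i) = k" "\<pi>' i = l"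
      using IB mem'[of k "Suc i"] mem'[of i l] D'(2)[of k] by auto
    have "\<pi> = conj_adj i \<pi>'"
      using IB f by (intro conj_eqI) (simp add: strands_conj_adj_IB[of \<pi>', OF D'(2)])
    moreover have "\<sigma> = \<sigma>' \<circ> transpose i (Suc i)"
      using IB f dom'[of i] dom'[of "Suc i"] in_n by (auto simp: sw)
    ultimately show ?thesis
      using IB f by (simp add: xs conj_adj_signed_def)
  next
    case (IC1 k l)
    have f: "\<pi>' (Suc i) = k" "\<pi>' i = l"
      using IC1 mem'[of "Suc i" k] mem'[of i l] by auto
    have "\<pi> = conj_adj i \<pi>'"
      using IC1 f by (intro conj_eqI) (simp add: strands_conj_adj_IC1[of \<pi>', OF D'(2)])
    moreover have "\<sigma> = \<sigma>' \<circ> transpose i (Suc i)"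
      using IC1 f dom'[of i] dom'[of "Suc i"] in_n by (auto simp: sw)
    ultimately show ?thesis
      using IC1 f by (simp add: xs conj_adj_signed_def)
  next
    case (IC2 l k)
    have f: "\<pi>' (Suc i) = l" "\<pi>' i = k"
      using IC2 mem'[of l "Suc i"] mem'[of k i] D'(2)[of k] D'(2)[of l] by auto
    have "\<pi> = conj_adj i \<pi>'"
      using IC2 f by (intro conj_eqI) (simp add: strands_conj_adj_IC2[of \<pi>', OF D'(2)])
    moreover have "\<sigma> = \<sigma>' \<circ> transpose i (Suc i)"
      using IC2 f dom'[of i] dom'[of "Suc i"] in_n by (auto simp: sw)
    ultimately show ?thesis
      using IC2 f by (simp add: xs conj_adj_signed_def)
  next
    case (II \<epsilon> \<delta>)
    have f: "\<pi>' i = Suc i" "\<pi>' (Suc i) = i"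
      using II mem'[of i "Suc i"] D'(2)[of i] by auto
    have "\<pi> = \<pi>'(i := i, Suc i := Suc i)"
    proof (rule eqI)
      show "strands \<pi> = strands (\<pi>'(i := i, Suc i := Suc i))"
        using II by (simp add: strands_fixed_II[of \<pi>', OF D'(2) f(1)])
      show "(\<pi>'(i := i, Suc i := Suc i)) ((\<pi>'(i := i, Suc i := Suc i)) a) = a" for a
        using f D'(2)[of a] by auto
    qed
    then show ?thesis
      using II f by (auto simp: xs unjoin_rel_def)
  qed
  moreover have "cover i (strands \<pi>', \<sigma>') (strands \<pi>, \<sigma>)"
    if desc: "\<pi>' (Suc i) < \<pi>' i"
      and rel: "if \<pi>' i = Suc i then unjoin_rel i x' x else x = conj_adj_signed i x'"
  proof (cases "\<pi>' i = Suc i")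
    case True
    then show ?thesis
      using rel cover.II[of i "strands \<pi>'" _ _ \<sigma>'] mem'[of i "Suc i"]
      by (auto simp: xs unjoin_rel_def strands_fixed_II[of \<pi>', OF D'(2)])
  next
    case False
    then have eq: "\<pi> = conj_adj i \<pi>'" "\<sigma> = \<sigma>' \<circ> transpose i (Suc i)"
      using rel by (simp_all add: xs conj_adj_signed_def)
    obtain k l where kl: "\<pi>' i = k" "\<pi>' (Suc i) = l"
      by simp
    have pre: "\<pi>' k = i" "\<pi>' l = Suc i"
      using D'(2) kl by metis+
    have ne: "k \<noteq> Suc i" "l \<noteq> i" "l < k"
      using False kl desc pre by auto
    have none: "\<sigma>' i = None" if "k \<noteq> i"
      using dom'[of i] in_n that kl by auto
    have none': "\<sigma>' (Suc i) = None" if "l \<noteq> Suc i"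
      using dom'[of "Suc i"] in_n that kl by auto
    \<comment> \<open>Given the descent \<open>l < k\<close> and the exclusion of a strand
      \<open>{i, i + 1}\<close>, these are the only positions of \<open>k\<close> and
      \<open>l\<close> relative to \<open>i\<close>, one for each conjugation type.\<close>
    consider (A1) "k = i" "l < i" | (A2) "l = Suc i" "Suc i < k" | (B) "l < i" "Suc i < k"
      | (C1) "Suc i < l" | (C2) "k < i"
      using ne by linarith
    then show ?thesis
    proof cases
      case A1
      obtain \<epsilon> where "\<sigma>' i = Some \<epsilon>"
        using dom'[of i] in_n A1 kl by auto
      then show ?thesis
        using cover.IA1[of l i \<sigma>' \<epsilon> "strands \<pi>'"] A1 kl pre mem' none'
        by (simp add: eq sw strands_conj_adj_IA1[of \<pi>', OF D'(2)])
    next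
      case A2
      obtain \<epsilon> where "\<sigma>' (Suc i) = Some \<epsilon>"
        using dom'[of "Suc i"] in_n A2 kl by auto
      then show ?thesis
        using cover.IA2[of i k "strands \<pi>'" \<sigma>' \<epsilon>] A2 kl pre mem' none
        by (simp add: eq sw strands_conj_adj_IA2[of \<pi>', OF D'(2)])
    next
      case B
      then have "\<sigma>' \<circ> transpose i (Suc i) = \<sigma>'"
        using none none' by (auto simp: sw)
      then show ?thesis
        using cover.IB[of l i k "strands \<pi>'" \<sigma>'] B kl pre mem'
        by (simp add: eq strands_conj_adj_IB[of \<pi>', OF D'(2)])
    next
      case C1
      then have "\<sigma>' \<circ> transpose i (Suc i) = \<sigma>'"
        using none none' ne by (auto simp: sw)
      then show ?thesis
        using cover.IC1[of i l k "strands \<pi>'" \<sigma>'] C1 ne kl pre mem'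
        by (simp add: eq strands_conj_adj_IC1[of \<pi>', OF D'(2)])
    next
      case C2
      then have "\<sigma>' \<circ> transpose i (Suc i) = \<sigma>'"
        using none none' ne by (auto simp: sw)
      then show ?thesis
        using cover.IC2[of l k i "strands \<pi>'" \<sigma>'] C2 ne kl pre mem'
        by (simp add: eq strands_conj_adj_IC2[of \<pi>', OF D'(2)])
    qed
  qed
  ultimately show ?thesis
    unfolding xs matching_of.simps fst_conv by blast
qed

section \<open>The length function along covers\<close>

text \<open>Every strand accounts for its two endpoints. Counting moved points instead of strands
  makes invariance under conjugation immediate, as conjugation transports supports
  bijectively.\<close>

lemma two_card_strands:
  assumes inv: "\<And>a. \<pi> (\<pi> a) = a" and fin: "finite {a. \<pi> a \<noteq> a}"
  shows "2 * card (strands \<pi>) = card {a. \<pi> a \<noteq> a}"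
proof -
  let ?U = "{a. a < \<pi> a}" and ?D = "{a. \<pi> a < a}"
  have "bij_betw fst (strands \<pi>) ?U"
    by (rule bij_betwI[where g = "\<lambda>a. (a, \<pi> a)"]) (auto simp: strands_def inv)
  then have 1: "card (strands \<pi>) = card ?U"
    by (rule bij_betw_same_card)
  have "bij_betw \<pi> ?U ?D"
    by (rule bij_betwI[where g = \<pi>]) (auto simp: inv)
  then have 2: "card ?U = card ?D"
    by (rule bij_betw_same_card)
  have "{a. \<pi> a \<noteq> a} = ?U \<union> ?D"
    by auto
  moreover have "finite ?U" "finite ?D"
    by (rule finite_subset[OF _ fin], auto)+
  ultimately have "card {a. \<pi> a \<noteq> a} = card ?U + card ?D"
    by (simp add: card_Un_disjoint disjoint_iff)
  with 1 2 show ?thesis by simp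
qed

lemma finite_support_permutes:
  fixes \<pi> :: "nat \<Rightarrow> nat"
  assumes "\<pi> permutes {1..n}"
  shows "finite {a. \<pi> a \<noteq> a}"
proof (rule finite_subset)
  show "{a. \<pi> a \<noteq> a} \<subseteq> {1..n}"
    using permutes_not_in[OF assms] by blast
qed simp

lemma conj_adj_permutes:
  assumes "\<pi> permutes {1..n}" "i \<in> {1..n - 1}"
  shows "conj_adj i \<pi> permutes {1..n}"
  unfolding conj_adj_def comp_assoc
proof (rule permutes_transpose_comp[OF _ assms(2)], rule permutes_compose[OF _ assms(1)])
  show "transpose i (Suc i) permutes {1..n}"
    using assms(2) by (intro permutes_swap_id) auto
qed

lemma card_strands_conj_adj:
  assumes "\<pi> permutes {1..n}" "i \<in> {1..n - 1}" and inv: "\<And>a. \<pi> (\<pi> a) = a"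
  shows "card (strands (conj_adj i \<pi>)) = card (strands \<pi>)"
proof -
  let ?s = "transpose i (Suc i)"
  have "bij_betw ?s {a. \<pi> a \<noteq> a} {a. conj_adj i \<pi> a \<noteq> a}"
    by (rule bij_betwI[where g = ?s]) (auto simp: conj_adj_def inj_eq[OF inj_transpose])
  then have "card {a. conj_adj i \<pi> a \<noteq> a} = card {a. \<pi> a \<noteq> a}"
    by (rule bij_betw_same_card[symmetric])
  then have "2 * card (strands (conj_adj i \<pi>)) = 2 * card (strands \<pi>)"
    using two_card_strands[of \<pi>, OF inv finite_support_permutes[OF assms(1)]]
      two_card_strands[of "conj_adj i \<pi>", OF conj_adj_involution[OF inv]
        finite_support_permutes[OF conj_adj_permutes[OF assms(1,2)]]] by simp
  then show ?thesis by simp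
qed

text \<open>Left and right multiplication each remove one inversion. The second does so because
  \<open>u < v\<close> survives the transposition unless \<open>{u, v} = {i, Suc i}\<close>, which
  is the excluded strand; in that case conjugation would change nothing.\<close>

lemma card_inversions_conj_adj:
  assumes p: "\<pi> permutes {1..n}" and i: "i \<in> {1..n - 1}" and invol: "\<And>a. \<pi> (\<pi> a) = a"
    and desc: "\<pi> (Suc i) < \<pi> i" and ne: "\<pi> i \<noteq> Suc i"
  shows "card (inversions \<pi>) = card (inversions (conj_adj i \<pi>)) + 2"
proof -
  let ?s = "transpose i (Suc i)"
  obtain u v where uv: "\<pi> (Suc i) = u" "\<pi> i = v" by simp
  have pre: "\<pi> u = Suc i" "\<pi> v = i"
    using invol uv by metis+
  have s: "?s permutes {1..n}"
    using i by (intro permutes_swap_id) auto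
  have p': "\<pi> \<circ> ?s permutes {1..n}"
    by (rule permutes_compose[OF s p])
  have "inv (?s \<circ> \<pi>) = \<pi> \<circ> ?s"
    by (rule inv_equality) (auto simp: invol)
  then have "card (inversions (\<pi> \<circ> ?s)) = card (inversions (?s \<circ> \<pi>))"
    using card_inversions_inv[OF permutes_transpose_comp[OF p i]] by simp
  moreover have "card (inversions \<pi>) = Suc (card (inversions (?s \<circ> \<pi>)))"
    using desc uv pre by (intro card_inversions_down[OF p i, of u v]) auto
  moreover have "card (inversions (\<pi> \<circ> ?s)) = Suc (card (inversions (?s \<circ> (\<pi> \<circ> ?s))))"
  proof (rule card_inversions_down[OF p' i])
    have "{u, v} \<noteq> {i, Suc i}"
      using ne uv desc pre by (auto simp: doubleton_eq_iff)
    then show "?s u < ?s v"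
      using desc uv by (simp add: transpose_Suc_less_iff)
  qed (use pre in auto)
  ultimately show ?thesis
    by (simp add: conj_adj_def comp_assoc)
qed

text \<open>The sum of inversions and strands drops by two for either kind of cover: conjugation
  loses two inversions and no strand, cutting a strand loses one of each. This is what the strand
  count in \<open>L_invol\<close> compensates.\<close>

lemma L_pm_cover:
  assumes x': "x' \<in> signed_involutions p q" and x: "x \<in> signed_involutions p q"
    and i: "i \<in> {1..p + q - 1}" and c: "cover i (matching_of x') (matching_of x)"
  shows "L_pm p q x = L_pm p q x' + 1"
proof -
  note D' = signed_involutionsD[OF x'] and D = signed_involutionsD[OF x]
  note cov = c[unfolded cover_iff[OF x' x i]]
  have len: "coxeter_length (p + q) (fst x') = card (inversions (fst x'))"
    "coxeter_length (p + q) (fst x) = card (inversions (fst x))"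
    using D(1) D'(1) by (simp_all only: coxeter_length_eq_card_inversions)
  have "card (inversions (fst x')) + card (strands (fst x')) =
    card (inversions (fst x)) + card (strands (fst x)) + 2"
  proof (cases "fst x' i = Suc i")
    case True
    then have pre: "fst x' (Suc i) = i" using D'(2)[of i] by simp
    have fx: "fst x = (fst x')(i := i, Suc i := Suc i)"
      using cov True by (simp add: unjoin_rel_def)
    \<comment> \<open>Cutting \<open>{i, i + 1}\<close> is a one-sided multiplication, hence costs a
      single inversion.\<close>
    have "transpose i (Suc i) \<circ> fst x' = fst x"
    proof
      fix a
      have "fst x' a \<noteq> i \<and> fst x' a \<noteq> Suc i" if "a \<noteq> i" "a \<noteq> Suc i"
        using D'(2)[of a] True pre that by metis
      then show "(transpose i (Suc i) \<circ> fst x') a = fst x a"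
        using True pre by (cases "a = i \<or> a = Suc i") (auto simp: fx)
    qed
    then have "card (inversions (fst x')) = Suc (card (inversions (fst x)))"
      using card_inversions_down[OF D'(1) i, of i "Suc i"] True pre by simp
    moreover have "card (strands (fst x')) = Suc (card (strands (fst x)))"
    proof -
      have "{a. fst x' a \<noteq> a} = insert i (insert (Suc i) {a. fst x a \<noteq> a})"
        using True pre by (auto simp: fx)
      then have "card {a. fst x' a \<noteq> a} = card {a. fst x a \<noteq> a} + 2"
        using finite_support_permutes[OF D(1)] by (simp add: fx)
      then show ?thesis
        using two_card_strands[of "fst x", OF D(2) finite_support_permutes[OF D(1)]]
          two_card_strands[of "fst x'", OF D'(2) finite_support_permutes[OF D'(1)]] by simp
    qed
    ultimately show ?thesis by simp
  next
    case False
    then have "fst x = conj_adj i (fst x')" "fst x' (Suc i) < fst x' i"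
      using cov by (simp_all add: conj_adj_signed_def)
    then show ?thesis
      using card_inversions_conj_adj[OF D'(1) i D'(2) _ False]
        card_strands_conj_adj[OF D'(1) i D'(2)] by simp
  qed
  then have "(of_nat (card (inversions (fst x'))) + of_nat (card (strands (fst x'))) :: rat) =
    of_nat (card (inversions (fst x))) + of_nat (card (strands (fst x))) + 2"
    by (metis of_nat_add of_nat_numeral)
  then show ?thesis
    by (simp add: L_pm_def L_invol_def len add_divide_distrib)
qed

section \<open>The minimal element and its rank\<close>

lemma two_card_increasing_pairs:
  "2 * card {(a, b). l < a \<and> a < b \<and> b \<le> l + m} = m * (m - 1)"
proof (induction m)
  case 0
  have *: "{(a, b). l < a \<and> a < b \<and> b \<le> l + 0} = {}" by auto
  show ?case unfolding * by simp
next
  case (Suc m)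
  let ?P = "\<lambda>m. {(a, b). l < a \<and> a < b \<and> b \<le> l + m}"
  have "?P (Suc m) = ?P m \<union> {l<..l + m} \<times> {l + Suc m}"
    by auto
  moreover have "finite (?P m)"
    by (rule finite_subset[of _ "{..l + m} \<times> {..l + m}"]) auto
  ultimately have "card (?P (Suc m)) = card (?P m) + m"
    by (simp add: card_Un_disjoint disjoint_iff card_cartesian_product)
  then show ?case
    using Suc by (cases m) (auto simp: algebra_simps)
qed

lemma fst_min_elt:
  "fst (min_elt p q) i = (if 1 \<le> i \<and> i \<le> q \<or> p < i \<and> i \<le> p + q then p + q + 1 - i else i)"
  by (auto simp: min_elt_def Let_def)

lemma snd_min_elt:
  "snd (min_elt p q) i = (if q < i \<and> i \<le> p then Some Plus else None)"
  by (auto simp: min_elt_def Let_def)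

lemma min_elt_involution:
  assumes "q \<le> p"
  shows "fst (min_elt p q) (fst (min_elt p q) a) = a"
  using assms by (auto simp: fst_min_elt)

lemma min_elt_in_signed_involutions:
  assumes "q \<le> p"
  shows "min_elt p q \<in> signed_involutions p q"
proof -
  let ?\<pi> = "fst (min_elt p q)" and ?\<sigma> = "snd (min_elt p q)"
  note inv = min_elt_involution[OF assms]
  have "?\<pi> permutes {1..p + q}"
    unfolding permutes_def
  proof (intro conjI allI impI)
    show "?\<pi> a = a" if "a \<notin> {1..p + q}" for a
      using that by (auto simp: fst_min_elt)
    show "\<exists>!a. ?\<pi> a = b" for b
      by (rule ex1I[of _ "?\<pi> b"]) (use inv in auto)
  qed
  moreover have "?\<pi> \<circ> ?\<pi> = id"
    using inv by (auto simp: fun_eq_iff)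
  moreover have "dom ?\<sigma> = {i \<in> {1..p + q}. ?\<pi> i = i}"
    using assms by (auto simp: dom_def snd_min_elt fst_min_elt)
  moreover have "{i. ?\<sigma> i = Some Plus} = {q<..p}" "{i. ?\<sigma> i = Some Minus} = {}"
    by (auto simp: snd_min_elt)
  ultimately show ?thesis
    using assms by (cases "min_elt p q") (auto simp: signed_involutions_def)
qed

text \<open>The minimal involution inverts every pair of points except those inside the fixed middle
  block of size \<open>p - q\<close>. The difference of the two binomial coefficients is
  \<open>2 * p * q - q\<close>, and the \<open>q\<close> strands complete it to
  \<open>2 * p * q\<close>.\<close>

lemma L_pm_min_elt:
  assumes "q \<le> p"
  shows "L_pm p q (min_elt p q) = 0"
proof -
  let ?\<pi> = "fst (min_elt p q)"
  note perm = signed_involutionsD(1)[OF min_elt_in_signed_involutions[OF assms]]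
  let ?A = "{(a, b). 0 < a \<and> a < b \<and> b \<le> 0 + (p + q)}"
  let ?B = "{(a, b). q < a \<and> a < b \<and> b \<le> q + (p - q)}"
  have "(a, b) \<in> inversions ?\<pi> \<longleftrightarrow> (a, b) \<in> ?A - ?B" for a b
    using assms unfolding inversions_def fst_min_elt
    by (cases "a \<le> q"; cases "b \<le> q"; cases "p < a"; cases "p < b"; cases "a = 0") auto
  then have "inversions ?\<pi> = ?A - ?B"
    by auto
  moreover have "finite ?A"
    by (rule finite_subset[of _ "{..p + q} \<times> {..p + q}"]) auto
  moreover have "?B \<subseteq> ?A"
    using assms by auto
  ultimately have inv: "card (inversions ?\<pi>) + card ?B = card ?A"
    using card_mono[of ?A ?B] by (simp add: card_Diff_subset finite_subset)
  have "{a. ?\<pi> a \<noteq> a} = {1..q} \<union> {p<..p + q}"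
    using assms by (auto simp: fst_min_elt)
  then have "card {a. ?\<pi> a \<noteq> a} = 2 * q"
    using assms by (simp add: card_Un_disjoint disjoint_iff)
  then have st: "card (strands ?\<pi>) = q"
    using two_card_strands[of ?\<pi>, OF min_elt_involution[OF assms] finite_support_permutes[OF perm]]
    by simp
  \<comment> \<open>Writing \<open>p = q + d\<close> eliminates the truncated subtraction before the
    arithmetic.\<close>
  obtain d where d: "p = q + d"
    using assms le_iff_add by blast
  have "2 * card (inversions ?\<pi>) + d * (d - 1) = (p + q) * (p + q - 1)"
    using inv two_card_increasing_pairs[of 0 "p + q"] two_card_increasing_pairs[of q "p - q"] d
    by simp
  then have "card (inversions ?\<pi>) + q = 2 * (p * q)"
    unfolding d by (cases d; cases q) (auto simp: algebra_simps)
  then have "(of_nat (card (inversions ?\<pi>)) + of_nat q :: rat) = 2 * (of_nat p * of_nat q)"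
    by (metis of_nat_add of_nat_mult of_nat_numeral)
  then show ?thesis
    using st coxeter_length_eq_card_inversions[OF perm] by (simp add: L_pm_def L_invol_def)
qed

section \<open>Admissible permutations\<close>

text \<open>The rules of the algorithm with the matching eliminated. In the second clause the pair
  at \<open>l\<close> is forced to be increasing, hence a strand; it may not enclose the pair
  removed earlier at \<open>j\<close>, in whichever order that pair stands. The third clause is the
  adjacency required of a pair of isolated vertices; it is vacuous for an increasing pair.\<close>

definition admissible :: "nat \<Rightarrow> nat \<Rightarrow> (nat \<Rightarrow> nat) \<Rightarrow> bool" where
  "admissible n q w \<longleftrightarrow>
     strict_mono_on {q + 1..n - q} w \<and>
     (\<forall>j l. 1 \<le> j \<longrightarrow> j < l \<longrightarrow> l \<le> q \<longrightarrow>
        \<not> (w l < w j \<and> w l < w (n + 1 - j) \<and> w j < w (n + 1 - l) \<and> w (n + 1 - j) < w (n + 1 - l))) \<and>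
     (\<forall>j x. 1 \<le> j \<longrightarrow> j \<le> q \<longrightarrow> j < x \<longrightarrow> x < n + 1 - j \<longrightarrow>
        \<not> (w (n + 1 - j) < w x \<and> w x < w j))"

text \<open>The image of \<open>w j\<close> under the involution that \<open>w\<close> prescribes.
  \<open>min\<close> and \<open>max\<close> pick the left and the right of the two mirror positions,
  so one formula serves both ends of a pair.\<close>

definition partner :: "nat \<Rightarrow> nat \<Rightarrow> (nat \<Rightarrow> nat) \<Rightarrow> nat \<Rightarrow> nat" where
  "partner n q w j =
     (if (j \<le> q \<or> n - q < j) \<and> w (min j (n + 1 - j)) < w (max j (n + 1 - j))
      then w (n + 1 - j) else w j)"

lemma admissible_mono:
  assumes "admissible n q w" "q < x" "x < y" "y \<le> n - q"
  shows "w x < w y"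
  using assms by (auto simp: admissible_def strict_mono_on_def)

lemma admissible_nest:
  assumes "admissible n q w" "1 \<le> j" "j < l" "l \<le> q"
    "w l < w j" "w l < w (n + 1 - j)" "w j < w (n + 1 - l)" "w (n + 1 - j) < w (n + 1 - l)"
  shows False
  using assms unfolding admissible_def by blast

lemma admissible_adj:
  assumes "admissible n q w" "1 \<le> j" "j \<le> q" "j < x" "x < n + 1 - j"
    "w (n + 1 - j) < w x" "w x < w j"
  shows False
  using assms unfolding admissible_def by blast

section \<open>Admissibility under left multiplication by an adjacent transposition\<close>

context
  fixes n q i u v :: nat and w w' :: "nat \<Rightarrow> nat"
  assumes qn: "2 * q \<le> n" and uv: "1 \<le> u" "u < v" "v \<le> n"
    and inj: "inj w" and wu: "w u = i" and wv: "w v = Suc i"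
  defines "w' \<equiv> transpose i (Suc i) \<circ> w"
begin

lemma less_iff: "w' x < w' y \<longleftrightarrow> x = v \<and> y = u \<or> w x < w y \<and> \<not> (x = u \<and> y = v)"
proof (cases "{w x, w y} = {i, Suc i}")
  case True
  then have "x = u \<and> y = v \<or> x = v \<and> y = u"
    using wu wv inj by (metis doubleton_eq_iff injD)
  then show ?thesis
    using uv wu wv by (auto simp: w'_def)
next
  case False
  then have "\<not> (x = u \<and> y = v)" "\<not> (x = v \<and> y = u)"
    using wu wv by auto
  then show ?thesis
    using transpose_Suc_less_iff[OF False] by (auto simp: w'_def)
qed

lemma ne_value: "x \<noteq> u \<Longrightarrow> w x \<noteq> i" "x \<noteq> v \<Longrightarrow> w x \<noteq> Suc i"
  using inj wu wv by (metis injD)+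

text \<open>Passing to \<open>w'\<close> only turns an ascent into a descent. Violations of the
  first and third clauses consist of descents and so persist. A violation of the second clause
  either persists or loses a comparison between a left and a right position, and then the exchanged
  values violate the third clause.\<close>

lemma admissible_transpose_imp_admissible:
  assumes adm: "admissible n q w'"
  shows "admissible n q w"
  unfolding admissible_def
proof (intro conjI allI impI notI)
  show "strict_mono_on {q + 1..n - q} w"
  proof (rule strict_mono_onI)
    fix x y assume "x \<in> {q + 1..n - q}" "y \<in> {q + 1..n - q}" "x < y"
    then show "w x < w y"
      using admissible_mono[OF adm, of x y] less_iff[of x y] uv(2) by auto
  qed
next
  fix j l
  assume jl: "1 \<le> j" "j < l" "l \<le> q"
    and "w l < w j \<and> w l < w (n + 1 - j) \<and> w j < w (n + 1 - l) \<and> w (n + 1 - j) < w (n + 1 - l)"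
  then have c: "w l < w j" "w l < w (n + 1 - j)" "w j < w (n + 1 - l)" "w (n + 1 - j) < w (n + 1 - l)"
    by auto
  have ord: "l < n + 1 - l" "n + 1 - l < n + 1 - j"
    using jl qn by auto
  have n: "\<not> (l = u \<and> j = v)" "\<not> (n + 1 - j = u \<and> n + 1 - l = v)"
    using ord jl uv by auto
  consider (a) "l = u" "n + 1 - j = v" | (b) "j = u" "n + 1 - l = v"
    | (same) "w' l < w' j" "w' l < w' (n + 1 - j)" "w' j < w' (n + 1 - l)" "w' (n + 1 - j) < w' (n + 1 - l)"
    using c n less_iff[of l j] less_iff[of l "n + 1 - j"] less_iff[of j "n + 1 - l"]
      less_iff[of "n + 1 - j" "n + 1 - l"] by blast
  then show False
  proof cases
    case a
    have "w' (n + 1 - j) < w' l" "w' l < w' j"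
      using a c n less_iff[of l j] less_iff[of "n + 1 - j" l] by simp_all
    then show False
      using jl qn by (intro admissible_adj[OF adm, of j l]) auto
  next
    case b
    have "w' (n + 1 - j) < w' (n + 1 - l)" "w' (n + 1 - l) < w' j"
      using b c n less_iff[of "n + 1 - l" j] less_iff[of "n + 1 - j" "n + 1 - l"] by simp_all
    then show False
      using jl qn by (intro admissible_adj[OF adm, of j "n + 1 - l"]) auto
  next
    case same
    then show False
      using jl by (intro admissible_nest[OF adm, of j l]) auto
  qed
next
  fix j x
  assume jx: "1 \<le> j" "j \<le> q" "j < x" "x < n + 1 - j"
    and "w (n + 1 - j) < w x \<and> w x < w j"
  then have "w' (n + 1 - j) < w' x" "w' x < w' j"
    using jx uv(2) less_iff[of "n + 1 - j" x] less_iff[of x j] by linarith+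
  then show False
    using jx by (intro admissible_adj[OF adm, of j x]) auto
qed

lemma partner_cases:
  assumes "1 \<le> x" "x \<le> n"
  obtains (left_strand) "x \<le> q" "w x < w (n + 1 - x)" "partner n q w x = w (n + 1 - x)"
  | (right_strand) "n - q < x" "w (n + 1 - x) < w x" "partner n q w x = w (n + 1 - x)"
  | (left_isolated) "x \<le> q" "w (n + 1 - x) < w x" "partner n q w x = w x"
  | (right_isolated) "n - q < x" "w x < w (n + 1 - x)" "partner n q w x = w x"
  | (middle) "q < x" "x \<le> n - q" "partner n q w x = w x"
proof -
  consider "x \<le> q" | "n - q < x" | "q < x" "x \<le> n - q"
    by linarith
  then show thesis
  proof cases
    case 1
    then have "x < n + 1 - x" using qn assms by auto
    moreover from this have "w x \<noteq> w (n + 1 - x)" by (simp add: inj_eq[OF inj])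
    ultimately show thesis
      using 1 left_strand left_isolated
      by (cases "w x < w (n + 1 - x)") (simp_all add: partner_def)
  next
    case 2
    then have "n + 1 - x < x" using qn assms by auto
    moreover from this have "w x \<noteq> w (n + 1 - x)" by (simp add: inj_eq[OF inj])
    ultimately show thesis
      using 2 right_strand right_isolated
      by (cases "w x < w (n + 1 - x)") (simp_all add: partner_def)
  next
    case 3
    then show thesis using middle by (auto simp: partner_def)
  qed
qed

text \<open>If \<open>u\<close> starts a strand on the left, or \<open>v\<close> ends one on the
  right, its partner tends to lie beyond both \<open>i\<close> and \<open>Suc i\<close>, which gives
  the descent; two strands on the same side are compared by the enclosure clause. In every other
  combination \<open>w'\<close> would break a clause: an exchanged value would fall inside a
  reversed pair, or the middle would cease to increase.\<close>

lemma admissible_transpose_imp_descent: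
  assumes adm: "admissible n q w'"
  shows "partner n q w v < partner n q w u"
proof (cases "n + 1 - u = v")
  case True
  then have vu: "n + 1 - v = u"
    using uv by auto
  have "\<not> (q < u \<and> v \<le> n - q)"
    using admissible_mono[OF adm, of u v] less_iff[of u v] uv by auto
  then have "u \<le> q \<or> n - q < u" "v \<le> q \<or> n - q < v"
    using True uv by auto
  then show ?thesis
    using True vu uv wu wv by (auto simp: partner_def)
next
  case False
  have u: "w (n + 1 - u) \<noteq> i" "w (n + 1 - u) \<noteq> Suc i" if "u \<le> q \<or> n - q < u"
    using False qn that uv by (intro ne_value; auto)+
  have v: "w (n + 1 - v) \<noteq> i" "w (n + 1 - v) \<noteq> Suc i" if "v \<le> q \<or> n - q < v"
    using False qn that uv by (intro ne_value; auto)+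
  have vu: "w' v < w' u"
    using less_iff by blast
  \<comment> \<open>Here \<open>v\<close> is the right end of a reversed pair with \<open>u\<close>
    in its window (in \<open>inside_u\<close>, \<open>u\<close> is the left end and \<open>v\<close>
    is in the window). Exchanging the adjacent values moves the inner one strictly between the
    values of the pair.\<close>
  have inside_v: False if "n - q < v" "w v < w (n + 1 - v)" "n + 1 - v < u"
  proof -
    have "w' u < w' (n + 1 - v)"
      using that v wu wv less_iff[of u "n + 1 - v"] by auto
    then show False
      using that vu uv by (intro admissible_adj[OF adm, of "n + 1 - v" u]) auto
  qed
  have inside_u: False if "u \<le> q" "w (n + 1 - u) < w u" "v < n + 1 - u"
  proof -
    have "w' (n + 1 - u) < w' v"
      using that wu wv less_iff[of "n + 1 - u" v] by auto
    then show False
      using that vu uv by (intro admissible_adj[OF adm, of u v]) auto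
  qed
  from uv have "1 \<le> u" "u \<le> n" by auto
  then show ?thesis
  proof (cases rule: partner_cases)
    case U: left_strand
    then have gt: "Suc i < partner n q w u"
      using u wu by auto
    from uv have "1 \<le> v" "v \<le> n" by auto
    then show ?thesis
    proof (cases rule: partner_cases)
      case V: left_strand
      have "\<not> w (n + 1 - u) < w (n + 1 - v)"
      proof
        assume "w (n + 1 - u) < w (n + 1 - v)"
        then have "w' (n + 1 - u) < w' (n + 1 - v)" "w' v < w' (n + 1 - u)" "w' u < w' (n + 1 - v)"
          using U V u v wu wv uv less_iff[of "n + 1 - u" "n + 1 - v"] less_iff[of v "n + 1 - u"]
            less_iff[of u "n + 1 - v"] by auto
        then show False
          using U V uv vu by (intro admissible_nest[OF adm, of u v]) auto
      qed
      moreover have "w (n + 1 - u) \<noteq> w (n + 1 - v)"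
        using U V uv qn inj_eq[OF inj] by auto
      ultimately show ?thesis
        using U V by auto
    qed (use gt wv in auto)
  next
    case U: right_strand
    then have u_inside: "n + 1 - v < u"
      using uv qn by linarith
    from uv have "1 \<le> v" "v \<le> n" by auto
    then show ?thesis
    proof (cases rule: partner_cases)
      case V: right_strand
      have "\<not> w (n + 1 - u) < w (n + 1 - v)"
      proof
        assume "w (n + 1 - u) < w (n + 1 - v)"
        then have "w' (n + 1 - u) < w' (n + 1 - v)" "w' (n + 1 - u) < w' v" "w' (n + 1 - v) < w' u"
          using U V u v wu wv uv less_iff[of "n + 1 - u" "n + 1 - v"] less_iff[of "n + 1 - u" v]
            less_iff[of "n + 1 - v" u] by auto
        \<comment> \<open>Both positions lie on the right, so the enclosure clause is applied to
          their mirror positions, which stand in the opposite order.\<close>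
        moreover have "1 \<le> n + 1 - v" "n + 1 - v < n + 1 - u" "n + 1 - u \<le> q"
          "n + 1 - (n + 1 - v) = v" "n + 1 - (n + 1 - u) = u"
          using U(1) uv qn by linarith+
        ultimately show False
          using admissible_nest[OF adm, of "n + 1 - v" "n + 1 - u"] vu by simp
      qed
      moreover have "w (n + 1 - u) \<noteq> w (n + 1 - v)"
        using U V uv inj_eq[OF inj] by auto
      ultimately show ?thesis
        using U V by auto
    next
      case right_isolated
      then show ?thesis using inside_v u_inside by blast
    qed (use U(1) uv qn in linarith)+
  next
    case U: left_isolated
    from uv have "1 \<le> v" "v \<le> n" by auto
    then show ?thesis
    proof (cases rule: partner_cases)
      case right_strand
      then show ?thesis using v U wu wv by auto
    next
      case right_isolated
      have "v < n + 1 - u \<or> n + 1 - v < u"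
        using False uv by linarith
      then show ?thesis using inside_v inside_u right_isolated U by blast
    next
      case left_strand
      moreover from this have "v < n + 1 - u" using U(1) qn by linarith
      ultimately show ?thesis using inside_u U by blast
    next
      case left_isolated
      moreover from this have "v < n + 1 - u" using U(1) qn by linarith
      ultimately show ?thesis using inside_u U by blast
    next
      case middle
      then have "v < n + 1 - u" using U(1) qn uv by linarith
      then show ?thesis using inside_u U by blast
    qed
  next
    case U: right_isolated
    then have u_inside: "n + 1 - v < u"
      using uv qn by linarith
    from uv have "1 \<le> v" "v \<le> n" by auto
    then show ?thesis
    proof (cases rule: partner_cases)
      case right_strand
      then show ?thesis using v U wu wv by auto
    next
      case right_isolated
      then show ?thesis using inside_v u_inside by blast
    qed (use U(1) uv qn in linarith)+
  next
    case U: middle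
    from uv have "1 \<le> v" "v \<le> n" by auto
    then show ?thesis
    proof (cases rule: partner_cases)
      case right_strand
      then show ?thesis using v U wu wv by auto
    next
      case right_isolated
      moreover from this have "n + 1 - v < u" using U(1) uv by linarith
      ultimately show ?thesis using inside_v by blast
    next
      case middle
      then show ?thesis
        using U uv vu admissible_mono[OF adm, of u v] by auto
    qed (use U uv qn in auto)
  qed
qed

text \<open>A violation new in \<open>w'\<close> must use the comparison of \<open>u\<close> and
  \<open>v\<close>. A new enclosure makes both of them ends of strands on the same side, with
  partners in the wrong order. If a value newly falls inside a reversed pair, the descent makes the
  inner position the end of a strand whose far end lies either inside that pair or beyond it; so
  \<open>w\<close> already violated the third or the second clause.\<close>

lemma descent_imp_admissible_transpose:
  assumes adm: "admissible n q w" and desc: "partner n q w v < partner n q w u"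
  shows "admissible n q w'"
  unfolding admissible_def
proof (intro conjI allI impI notI)
  show "strict_mono_on {q + 1..n - q} w'"
  proof (rule strict_mono_onI)
    fix x y assume xy: "x \<in> {q + 1..n - q}" "y \<in> {q + 1..n - q}" "x < y"
    then have "w x < w y"
      by (intro admissible_mono[OF adm]) auto
    moreover have "\<not> (x = u \<and> y = v)"
      using xy desc wu wv by (auto simp: partner_def)
    ultimately show "w' x < w' y"
      by (simp add: less_iff)
  qed
next
  fix j l
  assume jl: "1 \<le> j" "j < l" "l \<le> q"
    and "w' l < w' j \<and> w' l < w' (n + 1 - j) \<and> w' j < w' (n + 1 - l) \<and> w' (n + 1 - j) < w' (n + 1 - l)"
  then have c: "w' l < w' j" "w' l < w' (n + 1 - j)" "w' j < w' (n + 1 - l)" "w' (n + 1 - j) < w' (n + 1 - l)"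
    by auto
  have ord: "l < n + 1 - l" "n + 1 - l < n + 1 - j"
    using jl qn by auto
  have n: "\<not> (l = v \<and> n + 1 - j = u)" "\<not> (j = v \<and> n + 1 - l = u)"
    using ord jl uv by auto
  consider (a) "j = u" "l = v" | (b) "n + 1 - l = u" "n + 1 - j = v"
    | (same) "w l < w j" "w l < w (n + 1 - j)" "w j < w (n + 1 - l)" "w (n + 1 - j) < w (n + 1 - l)"
    using c n less_iff[of l j] less_iff[of l "n + 1 - j"] less_iff[of j "n + 1 - l"]
      less_iff[of "n + 1 - j" "n + 1 - l"] by blast
  then show False
  proof cases
    case a
    then have o: "w l < w (n + 1 - j)" "w j < w (n + 1 - l)" "w (n + 1 - j) < w (n + 1 - l)"
      using c n a ord uv(2) less_iff[of l "n + 1 - j"] less_iff[of j "n + 1 - l"]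
        less_iff[of "n + 1 - j" "n + 1 - l"] by simp_all
    have "partner n q w u = w (n + 1 - j)" "partner n q w v = w (n + 1 - l)"
      using a o wu wv jl qn by (auto simp: partner_def)
    then show False
      using o desc by simp
  next
    case b
    then have o: "w l < w j" "w j < w (n + 1 - l)" "w l < w (n + 1 - j)"
      using c n b ord uv(2) less_iff[of l j] less_iff[of l "n + 1 - j"] less_iff[of j "n + 1 - l"]
      by simp_all
    have "n + 1 - u = l" "n + 1 - v = j" "l < u" "j < v" "n - q < u" "n - q < v"
      using b jl qn by linarith+
    then have "partner n q w u = w l" "partner n q w v = w j"
      using b o wu wv by (simp_all add: partner_def)
    then show False
      using o desc by simp
  next
    case same
    then show False
      using jl by (intro admissible_nest[OF adm, of j l]) auto
  qed
next
  fix j x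
  assume jx: "1 \<le> j" "j \<le> q" "j < x" "x < n + 1 - j"
    and "w' (n + 1 - j) < w' x \<and> w' x < w' j"
  then have c: "w' (n + 1 - j) < w' x" "w' x < w' j"
    by auto
  \<comment> \<open>Were \<open>u\<close> and \<open>v\<close> themselves this pair, its values in
    \<open>w'\<close> would be \<open>Suc i\<close> and \<open>i\<close>, with no room in
    between.\<close>
  have n: "\<not> (n + 1 - j = v \<and> j = u)"
    using c less_iff[of x j] less_iff[of "n + 1 - j" x] wu wv jx by auto
  consider (a) "n + 1 - j = v" "x = u" | (b) "j = u" "x = v"
    | (same) "w (n + 1 - j) < w x" "w x < w j"
    using c n less_iff[of x j] less_iff[of "n + 1 - j" x] by blast
  then show False
  proof cases
    case a
    have wj: "Suc i < w j"
      using a c(2) less_iff[of x j] ne_value(2)[of j] wu jx by auto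
    have "n + 1 - v = j"
      using a jx qn by auto
    then have "partner n q w v = Suc i"
      using wj a wv jx qn by (auto simp: partner_def min_def max_def)
    then have "Suc i < partner n q w u"
      using desc by simp
    then have u: "u \<le> q \<or> n - q < u" "w (min u (n + 1 - u)) < w (max u (n + 1 - u))"
      and wu': "Suc i < w (n + 1 - u)"
      using wu by (auto simp: partner_def split: if_splits)
    have left: "u < n + 1 - u"
    proof (rule ccontr)
      assume "\<not> u < n + 1 - u"
      then have "w (n + 1 - u) < w u"
        using u(2) by (simp add: min_absorb2 max_absorb1)
      then show False
        using wu' wu by simp
    qed
    then have "u \<le> q"
      using u(1) qn by auto
    have "w (n + 1 - u) \<noteq> w j"
      using left a jx by (simp add: inj_eq[OF inj])
    then consider "w (n + 1 - u) < w j" | "w j < w (n + 1 - u)"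
      by linarith
    then show False
    proof cases
      case 1
      then show False
        using wu' wv a jx left by (intro admissible_adj[OF adm, of j "n + 1 - u"]) auto
    next
      case 2
      then show False
        using wu' wu wv wj a jx \<open>u \<le> q\<close> by (intro admissible_nest[OF adm, of j u]) auto
    qed
  next
    case b
    have wj': "w (n + 1 - j) < i"
      using b c(1) less_iff[of "n + 1 - j" x] ne_value(1)[of "n + 1 - j"] wv jx by auto
    then have "partner n q w u = i"
      using b wu jx qn by (auto simp: partner_def min_def max_def)
    then have "partner n q w v < i"
      using desc by simp
    then have v: "v \<le> q \<or> n - q < v" "w (min v (n + 1 - v)) < w (max v (n + 1 - v))"
      and wv': "w (n + 1 - v) < i"
      using wv by (auto simp: partner_def split: if_splits)
    have right: "n + 1 - v < v"
    proof (rule ccontr)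
      assume "\<not> n + 1 - v < v"
      then have "w v < w (n + 1 - v)"
        using v(2) by (simp add: min_absorb1 max_absorb2)
      then show False
        using wv' wv by simp
    qed
    then have l: "n + 1 - v \<le> q" "n + 1 - (n + 1 - v) = v" "j < n + 1 - v" "n + 1 - v < n + 1 - j"
      using v(1) qn uv b jx by auto
    then have "w (n + 1 - v) \<noteq> w (n + 1 - j)"
      by (simp add: inj_eq[OF inj])
    then consider "w (n + 1 - j) < w (n + 1 - v)" | "w (n + 1 - v) < w (n + 1 - j)"
      by linarith
    then show False
    proof cases
      case 1
      then show False
        using wv' wu b jx l by (intro admissible_adj[OF adm, of j "n + 1 - v"]) auto
    next
      case 2
      then show False
        using wv' wj' wu wv b jx l by (intro admissible_nest[OF adm, of j "n + 1 - v"]) auto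
    qed
  next
    case same
    then show False
      using jx by (intro admissible_adj[OF adm, of j x]) auto
  qed
qed

end

section \<open>Signed involutions compatible with a permutation\<close>

text \<open>The sign \<open>Plus\<close> in the last clause is forced: every reversed pair
  contributes one sign of each kind, so the surplus \<open>p - q\<close> must come from the
  \<open>p - q\<close> middle values.\<close>

definition compatible :: "nat \<Rightarrow> nat \<Rightarrow> signed_invol \<Rightarrow> (nat \<Rightarrow> nat) \<Rightarrow> bool" where
  "compatible p q x w \<longleftrightarrow>
     (\<forall>j \<in> {1..p + q}. fst x (w j) = partner (p + q) q w j) \<and>
     (\<forall>j \<in> {1..q}. fst x (w j) = w j \<longrightarrow> snd x (w j) \<noteq> snd x (w (p + q + 1 - j))) \<and>
     (\<forall>j \<in> {q + 1..p}. snd x (w j) = Some Plus)"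

lemma compatibleD:
  assumes "compatible p q x w"
  shows "1 \<le> j \<Longrightarrow> j \<le> p + q \<Longrightarrow> fst x (w j) = partner (p + q) q w j"
    and "1 \<le> j \<Longrightarrow> j \<le> q \<Longrightarrow> fst x (w j) = w j \<Longrightarrow> snd x (w j) \<noteq> snd x (w (p + q + 1 - j))"
    and "q < j \<Longrightarrow> j \<le> p \<Longrightarrow> snd x (w j) = Some Plus"
  using assms by (auto simp: compatible_def)

lemma partner_mem: "partner n q w j \<in> {w j, w (n + 1 - j)}"
  by (simp add: partner_def)

text \<open>As \<open>u\<close> and \<open>v\<close> are not mirror positions, none of the
  comparisons that decide between strand and isolated vertices is affected.\<close>

lemma partner_transpose:
  assumes "1 \<le> u" "u < v" "v \<le> n" "inj w" "w u = i" "w v = Suc i" "n + 1 - u \<noteq> v" "1 \<le> j" "j \<le> n"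
  shows "partner n q (transpose i (Suc i) \<circ> w) j = transpose i (Suc i) (partner n q w j)"
proof -
  have "\<not> (min j (n + 1 - j) = u \<and> max j (n + 1 - j) = v)" "\<not> (min j (n + 1 - j) = v \<and> max j (n + 1 - j) = u)"
    using assms by (auto simp: min_def max_def split: if_splits)
  then have "{w (min j (n + 1 - j)), w (max j (n + 1 - j))} \<noteq> {i, Suc i}"
    using assms(4-6) by (metis doubleton_eq_iff injD)
  from transpose_Suc_less_iff[OF this] show ?thesis
    by (simp add: partner_def)
qed

lemma transpose_eq_flip: "transpose a b c = d \<longleftrightarrow> c = transpose a b d"
  by (metis transpose_involutory)

lemma conj_adj_signed_in_signed_involutions:
  assumes x: "x \<in> signed_involutions p q" and i: "i \<in> {1..p + q - 1}"
  shows "conj_adj_signed i x \<in> signed_involutions p q"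
proof -
  let ?s = "transpose i (Suc i)"
  note D = signed_involutionsD[OF x]
  have s: "?s a \<in> {1..p + q} \<longleftrightarrow> a \<in> {1..p + q}" for a
    using i by (intro permutes_in_image permutes_swap_id) auto
  have "conj_adj i (fst x) \<circ> conj_adj i (fst x) = id"
    using conj_adj_involution[of "fst x", OF D(2)] by (auto simp: fun_eq_iff)
  moreover have "dom (snd x \<circ> ?s) = {a \<in> {1..p + q}. conj_adj i (fst x) a = a}"
  proof -
    have "a \<in> dom (snd x \<circ> ?s) \<longleftrightarrow> ?s a \<in> dom (snd x)" for a
      by (simp add: dom_def)
    also have "\<dots> a \<longleftrightarrow> a \<in> {1..p + q} \<and> conj_adj i (fst x) a = a" for a
      using s[of a] by (auto simp: D(3) conj_adj_def transpose_eq_flip)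
    finally show ?thesis by blast
  qed
  moreover have "card {a. (snd x \<circ> ?s) a = Some \<epsilon>} = card {a. snd x a = Some \<epsilon>}" for \<epsilon>
  proof (rule bij_betw_same_card)
    show "bij_betw ?s {a. (snd x \<circ> ?s) a = Some \<epsilon>} {a. snd x a = Some \<epsilon>}"
      by (rule bij_betwI[where g = ?s]) auto
  qed
  ultimately show ?thesis
    using conj_adj_permutes[OF D(1) i] D(4)
    by (simp add: signed_involutions_def conj_adj_signed_def)
qed

section \<open>Compatibility along a cover\<close>

context
  fixes p q i u v :: nat and w :: "nat \<Rightarrow> nat"
  assumes qp: "q \<le> p" and i: "i \<in> {1..p + q - 1}" and w: "w permutes {1..p + q}"
    and uv: "1 \<le> u" "u < v" "v \<le> p + q" and wu: "w u = i" and wv: "w v = Suc i"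
begin

abbreviation (input) "w\<^sub>s \<equiv> transpose i (Suc i) \<circ> w"

lemma inj_w: "inj w"
  using w by (rule permutes_inj)

lemma w_other: "j \<noteq> u \<Longrightarrow> j \<noteq> v \<Longrightarrow> w j \<noteq> i \<and> w j \<noteq> Suc i"
  using inj_w wu wv by (metis injD)

text \<open>Separates the two kinds of cover: a strand \<open>{i, i + 1}\<close> can arise only when
  \<open>u\<close> and \<open>v\<close> are mirror positions.\<close>

lemma partner_ne_of_unpaired:
  assumes "p + q + 1 - u \<noteq> v"
  shows "partner (p + q) q w u \<noteq> Suc i"
proof
  assume "partner (p + q) q w u = Suc i"
  then have "w (p + q + 1 - u) = Suc i"
    using partner_mem[of "p + q" q w u] wu by auto
  with assms show False
    using inj_w wv by (metis injD)
qed

text \<open>The partner values for \<open>w\<close> and \<open>w\<^sub>s\<close> coincide for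
  different reasons: in \<open>w\<close> the pair increases and is joined; in
  \<open>w\<^sub>s\<close> it is reversed, and each value is its own partner. The descent rules out
  the middle, where nothing is joined.\<close>

lemma paired_outer:
  assumes "p + q + 1 - u = v" and "partner (p + q) q w v < partner (p + q) q w u"
  shows "u \<le> q" "p < v" "partner (p + q) q w u = Suc i" "partner (p + q) q w v = i"
    "partner (p + q) q w\<^sub>s u = Suc i" "partner (p + q) q w\<^sub>s v = i"
    "p + q + 1 - v = u"
proof -
  show vu: "p + q + 1 - v = u" using assms(1) uv by linarith
  show u: "u \<le> q"
  proof (rule ccontr)
    assume "\<not> u \<le> q"
    then have "\<not> (u \<le> q \<or> p + q - q < u)" "\<not> (v \<le> q \<or> p + q - q < v)"
      using assms(1) uv by linarith+
    then show False
      using assms(2) wu wv by (simp add: partner_def)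
  qed
  show v: "p < v" using u assms(1) by linarith
  show "partner (p + q) q w u = Suc i" "partner (p + q) q w v = i"
    "partner (p + q) q w\<^sub>s u = Suc i" "partner (p + q) q w\<^sub>s v = i"
    unfolding partner_def assms(1) vu using u v uv wu wv by simp_all
qed

lemma partner_other:
  assumes "p + q + 1 - u = v" "1 \<le> j" "j \<le> p + q" "j \<noteq> u" "j \<noteq> v"
  shows "partner (p + q) q w\<^sub>s j = partner (p + q) q w j"
    "w j \<notin> {i, Suc i}" "w (p + q + 1 - j) \<notin> {i, Suc i}"
proof -
  have "p + q + 1 - j \<noteq> u" "p + q + 1 - j \<noteq> v"
    using assms uv by linarith+
  then show "w (p + q + 1 - j) \<notin> {i, Suc i}" and "w j \<notin> {i, Suc i}"
    using w_other assms by auto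
  then show "partner (p + q) q w\<^sub>s j = partner (p + q) q w j"
    by (simp add: partner_def min_def max_def)
qed

text \<open>The inverse of the type II move. Joining two isolated vertices of opposite signs deletes
  one sign of each kind, so the signed count is kept.\<close>

lemma unjoin_in_signed_involutions:
  assumes x: "x \<in> signed_involutions p q" and fixed: "fst x i = i" "fst x (Suc i) = Suc i"
    and signs: "snd x i \<noteq> snd x (Suc i)"
  shows "((fst x)(i := Suc i, Suc i := i), (snd x)(i := None, Suc i := None)) \<in> signed_involutions p q"
proof -
  note D = signed_involutionsD[OF x]
  let ?\<pi> = "(fst x)(i := Suc i, Suc i := i)" and ?\<sigma> = "(snd x)(i := None, Suc i := None)"
  have in_n: "i \<in> {1..p + q}" "Suc i \<in> {1..p + q}"
    using i by auto
  have "i \<in> dom (snd x)" "Suc i \<in> dom (snd x)"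
    using in_n fixed D(3) by auto
  then obtain \<epsilon> \<delta> where sg: "snd x i = Some \<epsilon>" "snd x (Suc i) = Some \<delta>"
    by auto
  have other: "fst x a \<noteq> i \<and> fst x a \<noteq> Suc i" if "a \<noteq> i" "a \<noteq> Suc i" for a
    using that fixed D(2)[of a] by metis
  have "?\<pi> \<circ> ?\<pi> = id"
  proof
    fix a show "(?\<pi> \<circ> ?\<pi>) a = id a"
      using other[of a] D(2)[of a] by simp
  qed
  moreover have "?\<pi> permutes {1..p + q}"
  proof -
    have "?\<pi> = transpose i (Suc i) \<circ> fst x"
    proof
      fix a show "?\<pi> a = (transpose i (Suc i) \<circ> fst x) a"
        using other[of a] fixed by simp
    qed
    then show ?thesis
      using permutes_transpose_comp[OF D(1) i] by simp
  qed
  moreover have "dom ?\<sigma> = {a \<in> {1..p + q}. ?\<pi> a = a}"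
    using D(3) by auto
  moreover have "int (card {a. ?\<sigma> a = Some Plus}) - int (card {a. ?\<sigma> a = Some Minus}) = int p - int q"
  proof -
    have fin: "finite {a. snd x a = Some s}" for s
    proof (rule finite_subset)
      show "{a. snd x a = Some s} \<subseteq> dom (snd x)" by auto
      show "finite (dom (snd x))" by (simp add: D(3))
    qed
    have c: "card {a. ?\<sigma> a = Some s} + 1 = card {a. snd x a = Some s}" for s
    proof -
      \<comment> \<open>Whichever of the two vertices carries the sign \<open>s\<close>.\<close>
      define b where "b = (if s = \<epsilon> then i else Suc i)"
      have "\<epsilon> \<noteq> \<delta>"
        using sg signs by auto
      then have b: "b \<in> {i, Suc i}" "snd x b = Some s" "\<forall>c \<in> {i, Suc i}. snd x c = Some s \<longrightarrow> c = b"
        using sg by (cases s; cases \<epsilon>; cases \<delta>; simp add: b_def)+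
      then have "{a. ?\<sigma> a = Some s} = {a. snd x a = Some s} - {b}"
        by auto
      then show ?thesis
        using b(2) fin[of s] card_Suc_Diff1[of "{a. snd x a = Some s}" b] by simp
    qed
    show ?thesis
      using c[of Plus] c[of Minus] D(4) by simp
  qed
  ultimately show ?thesis
    by (simp add: signed_involutions_def)
qed

text \<open>At \<open>i\<close> and \<open>Suc i\<close> the lower involution takes the partner
  values of \<open>u\<close> and \<open>v\<close>. The descent demanded by the cover is therefore
  the condition that governs admissibility.\<close>

lemma compatible_up:
  assumes x': "x' \<in> signed_involutions p q" and x: "x \<in> signed_involutions p q"
    and cov: "cover i (matching_of x') (matching_of x)" and comp: "compatible p q x' w"
  shows "compatible p q x w\<^sub>s" and "partner (p + q) q w v < partner (p + q) q w u"
proof -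
  note cov = cov[unfolded cover_iff[OF x' x i]]
  note C = compatibleD[OF comp]
  have pu: "fst x' i = partner (p + q) q w u" and pv: "fst x' (Suc i) = partner (p + q) q w v"
    using C(1)[of u] C(1)[of v] uv wu wv by auto
  then show desc: "partner (p + q) q w v < partner (p + q) q w u"
    using cov by simp
  show "compatible p q x w\<^sub>s"
  proof (cases "p + q + 1 - u = v")
    case False
    then have "x = conj_adj_signed i x'"
      using cov pu partner_ne_of_unpaired by simp
    then have fx: "fst x (w\<^sub>s j) = transpose i (Suc i) (fst x' (w j))" and sx: "snd x (w\<^sub>s j) = snd x' (w j)" for j
      by (simp_all add: conj_adj_signed_def conj_adj_def)
    show ?thesis
      unfolding compatible_def
    proof (intro conjI ballI impI)
      fix j assume j: "j \<in> {1..q}" "fst x (w\<^sub>s j) = w\<^sub>s j"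
      then have "fst x' (w j) = w j"
        unfolding fx by (simp add: inj_eq[OF inj_transpose])
      then show "snd x (w\<^sub>s j) \<noteq> snd x (w\<^sub>s (p + q + 1 - j))"
        unfolding sx using C(2)[of j] j by simp
    qed (use fx sx C(1,3) partner_transpose[OF uv inj_w wu wv False] in simp_all)
  next
    case True
    note P = paired_outer[OF True desc]
    have "unjoin_rel i x' x"
      using cov pu P by simp
    then obtain \<epsilon> \<delta> where fx: "fst x = (fst x')(i := i, Suc i := Suc i)"
      and sx: "snd x = (snd x')(i := Some \<epsilon>, Suc i := Some \<delta>)" and ne: "\<epsilon> \<noteq> \<delta>"
      unfolding unjoin_rel_def by blast
    show ?thesis
      unfolding compatible_def
    proof (intro conjI ballI impI)
      fix j assume j: "j \<in> {1..p + q}"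
      show "fst x (w\<^sub>s j) = partner (p + q) q w\<^sub>s j"
      proof (cases "j = u \<or> j = v")
        case True
        then show ?thesis using P wu wv by (auto simp: fx)
      next
        case False
        then show ?thesis
          using partner_other[OF True, of j] C(1)[of j] j by (simp add: fx)
      qed
    next
      fix j assume j: "j \<in> {1..q}"
      assume fixed: "fst x (w\<^sub>s j) = w\<^sub>s j"
      show "snd x (w\<^sub>s j) \<noteq> snd x (w\<^sub>s (p + q + 1 - j))"
      proof (cases "j = u")
        case True
        then show ?thesis using ne wu wv \<open>p + q + 1 - u = v\<close> by (simp add: sx)
      next
        case False
        moreover have "j \<noteq> v" using j P(2) qp by simp
        ultimately show ?thesis
          using partner_other[OF True, of j] C(2)[of j] j fixed by (simp add: fx sx)
      qed
    next
      fix j assume j: "j \<in> {q + 1..p}"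
      then have "j \<noteq> u" "j \<noteq> v" using P by auto
      then show "snd x (w\<^sub>s j) = Some Plus"
        using partner_other[OF True, of j] C(3)[of j] j by (simp add: sx)
    qed
  qed
qed

text \<open>Both kinds of cover can be undone: a conjugation by repeating it, a cut by joining
  \<open>i\<close> to \<open>i + 1\<close>. In the second case the opposite signs come from the
  reversed pair of \<open>w\<^sub>s\<close> at \<open>u\<close>.\<close>

lemma compatible_down:
  assumes x: "x \<in> signed_involutions p q" and comp: "compatible p q x w\<^sub>s"
    and desc: "partner (p + q) q w v < partner (p + q) q w u"
  obtains x' where "x' \<in> signed_involutions p q" "cover i (matching_of x') (matching_of x)"
    "compatible p q x' w"
proof (cases "p + q + 1 - u = v")
  case False
  let ?x = "conj_adj_signed i x"
  note C = compatibleD[OF comp]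
  have SI: "?x \<in> signed_involutions p q"
    by (rule conj_adj_signed_in_signed_involutions[OF x i])
  have fx: "fst ?x (w j) = transpose i (Suc i) (fst x (w\<^sub>s j))" and sx: "snd ?x (w j) = snd x (w\<^sub>s j)" for j
    by (simp_all add: conj_adj_signed_def conj_adj_def)
  have fx_partner: "fst ?x (w j) = partner (p + q) q w j" if "1 \<le> j" "j \<le> p + q" for j
    unfolding fx using C(1)[of j] partner_transpose[OF uv inj_w wu wv False that] that by simp
  have comp': "compatible p q ?x w"
    unfolding compatible_def
  proof (intro conjI ballI impI)
    fix j assume j: "j \<in> {1..q}" "fst ?x (w j) = w j"
    then have "fst x (w\<^sub>s j) = w\<^sub>s j"
      unfolding fx by (simp add: transpose_eq_flip)
    then show "snd ?x (w j) \<noteq> snd ?x (w (p + q + 1 - j))"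
      unfolding sx using C(2)[of j] j by simp
  qed (use fx_partner sx C(3) in simp_all)
  have "fst ?x i = partner (p + q) q w u" "fst ?x (Suc i) = partner (p + q) q w v"
    using fx_partner[of u] fx_partner[of v] uv wu wv by simp_all
  moreover have "x = conj_adj_signed i ?x"
    by (simp add: conj_adj_signed_def comp_assoc)
  ultimately have "cover i (matching_of ?x) (matching_of x)"
    using desc partner_ne_of_unpaired[OF False] cover_iff[OF SI x i] by simp
  with SI comp' show thesis
    using that by blast
next
  case True
  note P = paired_outer[OF True desc]
  note C = compatibleD[OF comp]
  note D = signed_involutionsD[OF x]
  have fixed: "fst x i = i" "fst x (Suc i) = Suc i"
    using C(1)[of u] C(1)[of v] P uv wu wv by simp_all
  have signs: "snd x (Suc i) \<noteq> snd x i"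
    using C(2)[of u] P uv wu wv fixed True by simp
  let ?x = "((fst x)(i := Suc i, Suc i := i), (snd x)(i := None, Suc i := None))"
  have SI: "?x \<in> signed_involutions p q"
    using unjoin_in_signed_involutions[OF x fixed] signs by simp
  have "compatible p q ?x w"
    unfolding compatible_def fst_conv snd_conv
  proof (intro conjI ballI impI)
    fix j assume j: "j \<in> {1..p + q}"
    show "((fst x)(i := Suc i, Suc i := i)) (w j) = partner (p + q) q w j"
    proof (cases "j = u \<or> j = v")
      case True
      then show ?thesis using P wu wv by auto
    next
      case False
      then show ?thesis
        using partner_other[OF True, of j] C(1)[of j] j by simp
    qed
  next
    fix j assume j: "j \<in> {1..q}" "((fst x)(i := Suc i, Suc i := i)) (w j) = w j"
    \<comment> \<open>At \<open>u\<close> the premise fails, since the value \<open>i\<close> is now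
      joined to \<open>Suc i\<close>.\<close>
    have "j \<noteq> u"
      using j wu by auto
    moreover have "j \<noteq> v"
      using j P(2) qp by simp
    ultimately show "((snd x)(i := None, Suc i := None)) (w j)
        \<noteq> ((snd x)(i := None, Suc i := None)) (w (p + q + 1 - j))"
      using partner_other[OF True, of j] C(2)[of j] j by simp
  next
    fix j assume j: "j \<in> {q + 1..p}"
    then have "j \<noteq> u" "j \<noteq> v" using P by auto
    then show "((snd x)(i := None, Suc i := None)) (w j) = Some Plus"
      using partner_other[OF True, of j] C(3)[of j] j by simp
  qed
  moreover have "cover i (matching_of ?x) (matching_of x)"
  proof -
    have "i \<in> dom (snd x)" "Suc i \<in> dom (snd x)"
      using i fixed D(3) by auto
    then obtain \<epsilon> \<delta> where sg: "snd x i = Some \<epsilon>" "snd x (Suc i) = Some \<delta>"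
      by auto
    then have "unjoin_rel i ?x x"
      using fixed signs unfolding unjoin_rel_def
      by (intro conjI exI[of _ \<epsilon>] exI[of _ \<delta>]) (auto simp: fun_eq_iff)
    then show ?thesis
      unfolding cover_iff[OF SI x i] by simp
  qed
  ultimately show thesis
    using SI that by blast
qed

end

section \<open>The algorithm\<close>

text \<open>The remaining set is expressed by \<open>w\<close> itself, as the values in the window
  \<open>j..n + 1 - j\<close>, so that a single step can be discussed without the run leading to
  it.\<close>

definition alg_step :: "nat \<Rightarrow> (nat \<times> nat) set \<Rightarrow> (nat \<rightharpoonup> sign) \<Rightarrow> (nat \<Rightarrow> nat) \<Rightarrow> nat \<Rightarrow> bool" where
  "alg_step n S \<sigma> w j \<longleftrightarrow>
     (w j, w (n + 1 - j)) \<in> S \<and> \<not> nested_in S (w ` {j..n + 1 - j}) (w j) (w (n + 1 - j)) \<or>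
     w (n + 1 - j) < w j \<and>
     (\<exists>\<epsilon> \<delta>. \<sigma> (w j) = Some \<epsilon> \<and> \<sigma> (w (n + 1 - j)) = Some \<delta> \<and> \<epsilon> \<noteq> \<delta>) \<and>
     \<not> (\<exists>x \<in> w ` {j..n + 1 - j}. w (n + 1 - j) < x \<and> x < w j) \<and>
     \<not> nested_in S (w ` {j..n + 1 - j}) (w (n + 1 - j)) (w j)"

text \<open>Different values at the two ends show that the window has at least two positions, which
  keeps the truncated differences honest.\<close>

lemma image_window_Suc:
  assumes inj: "inj w" and "w (Suc j) \<in> w ` {j + 1..n - j}" and "w (Suc j) \<noteq> w (n - j)"
  shows "2 * Suc j \<le> n" and "w ` {j + 1..n - j} - {w (Suc j), w (n - j)} = w ` {Suc j + 1..n - Suc j}"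
proof -
  have "Suc j \<in> {j + 1..n - j}"
    using assms by (simp add: inj_image_mem_iff)
  moreover have "Suc j \<noteq> n - j"
    using assms(3) by metis
  ultimately have "Suc j < n - j" by simp
  then show "2 * Suc j \<le> n" by presburger
  have "{j + 1..n - j} - {Suc j, n - j} = {Suc j + 1..n - Suc j}"
    by auto
  moreover have "w ` {j + 1..n - j} - {w (Suc j), w (n - j)} = w ` ({j + 1..n - j} - {Suc j, n - j})"
    by (simp add: image_set_diff[OF inj])
  ultimately show "w ` {j + 1..n - j} - {w (Suc j), w (n - j)} = w ` {Suc j + 1..n - Suc j}"
    by simp
qed

lemma alg_run_window:
  assumes "alg_run n S \<sigma> w k A" and w: "w permutes {1..n}" and S: "\<And>a b. (a, b) \<in> S \<Longrightarrow> a < b"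
  shows "2 * k \<le> n \<and> A = w ` {k + 1..n - k} \<and> (\<forall>j \<in> {1..k}. alg_step n S \<sigma> w j)"
  using assms(1)
proof induction
  case start
  then show ?case using permutes_image[OF w] by simp
next
  case (strand j A a b)
  have A: "A = w ` {j + 1..n - j}" and steps: "\<forall>j \<in> {1..j}. alg_step n S \<sigma> w j"
    using strand.IH by blast+
  have ab: "w (Suc j) = a" "w (n - j) = b" "a \<noteq> b"
    using strand.hyps S[of a b] by auto
  have "a \<in> w ` {j + 1..n - j}" using strand.hyps A by blast
  then have win: "2 * Suc j \<le> n" "A - {a, b} = w ` {Suc j + 1..n - Suc j}"
    using image_window_Suc[OF permutes_inj[OF w], of j n] ab A by auto
  have "alg_step n S \<sigma> w (Suc j)"
    using strand.hyps ab A unfolding alg_step_def by simp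
  with win steps show ?case
    by (auto simp: atLeastAtMostSuc_conv)
next
  case (isolated j A a b \<epsilon> \<delta>)
  have A: "A = w ` {j + 1..n - j}" and steps: "\<forall>j \<in> {1..j}. alg_step n S \<sigma> w j"
    using isolated.IH by blast+
  have ab: "w (Suc j) = b" "w (n - j) = a" "a \<noteq> b"
    using isolated.hyps by auto
  have "b \<in> w ` {j + 1..n - j}" using isolated.hyps A by blast
  then have win: "2 * Suc j \<le> n" "A - {a, b} = w ` {Suc j + 1..n - Suc j}"
    using image_window_Suc[OF permutes_inj[OF w], of j n] ab A by auto
  have "alg_step n S \<sigma> w (Suc j)"
    using isolated.hyps ab A unfolding alg_step_def by simp
  with win steps show ?case
    by (auto simp: atLeastAtMostSuc_conv)
qed

section \<open>The sign balance as an invariant of the algorithm\<close>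

definition balance :: "(nat \<rightharpoonup> sign) \<Rightarrow> nat set \<Rightarrow> int" where
  "balance \<sigma> A = int (card {a \<in> A. \<sigma> a = Some Plus}) - int (card {a \<in> A. \<sigma> a = Some Minus})"

lemma balance_remove_unsigned:
  assumes "\<sigma> a = None" "\<sigma> b = None"
  shows "balance \<sigma> (A - {a, b}) = balance \<sigma> A"
proof -
  have "{c \<in> A - {a, b}. \<sigma> c = Some s} = {c \<in> A. \<sigma> c = Some s}" for s
    using assms by auto
  then show ?thesis by (simp add: balance_def)
qed

lemma balance_remove_opposite:
  assumes fin: "finite A" and ab: "a \<in> A" "b \<in> A"
    and sg: "\<sigma> a = Some \<epsilon>" "\<sigma> b = Some \<delta>" "\<epsilon> \<noteq> \<delta>"
  shows "balance \<sigma> (A - {a, b}) = balance \<sigma> A"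
proof -
  have "card {c \<in> A. \<sigma> c = Some s} = Suc (card {c \<in> A - {a, b}. \<sigma> c = Some s})" for s
  proof -
    define d where "d = (if s = \<epsilon> then a else b)"
    have d: "d \<in> A" "d \<in> {a, b}" "\<sigma> d = Some s" "\<forall>c \<in> {a, b}. \<sigma> c = Some s \<longrightarrow> c = d"
      using ab sg by (cases s; cases \<epsilon>; cases \<delta>; simp add: d_def)+
    then have "{c \<in> A. \<sigma> c = Some s} = insert d {c \<in> A - {a, b}. \<sigma> c = Some s}"
      by auto
    moreover have "d \<notin> {c \<in> A - {a, b}. \<sigma> c = Some s}"
      using d by auto
    ultimately show ?thesis
      using fin by simp
  qed
  then show ?thesis by (simp add: balance_def)
qed

lemma alg_run_balance:
  assumes "alg_run n S \<sigma> w k A" and "\<And>a b. (a, b) \<in> S \<Longrightarrow> \<sigma> a = None \<and> \<sigma> b = None"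
  shows "finite A \<and> balance \<sigma> A = balance \<sigma> {1..n}"
  using assms(1)
proof induction
  case (strand j A a b)
  then show ?case
    using assms(2)[of a b] balance_remove_unsigned[of \<sigma> a b A] by simp
next
  case (isolated j A a b \<epsilon> \<delta>)
  then show ?case
    using balance_remove_opposite[of A a b \<sigma> \<epsilon> \<delta>] by simp
qed simp

text \<open>The balance of a monochromatic set is its cardinality up to sign, so a nonnegative
  balance fixes the size and, if the set is nonempty, the sign. The guard \<open>finite A\<close>
  excludes infinite sets, whose \<open>card\<close> is 0.\<close>

lemma balance_monochromatic:
  assumes "monochromatic \<sigma> A" "balance \<sigma> A = int d"
  shows "card A = d" "\<forall>a \<in> A. finite A \<longrightarrow> \<sigma> a = Some Plus"
proof -
  obtain \<epsilon> where e: "\<forall>a \<in> A. \<sigma> a = Some \<epsilon>"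
    using assms(1) unfolding monochromatic_def by blast
  then have sets: "{a \<in> A. \<sigma> a = Some s} = (if s = \<epsilon> then A else {})" for s
    by auto
  have "card A = d \<and> (\<forall>a \<in> A. finite A \<longrightarrow> \<sigma> a = Some Plus)"
  proof (cases \<epsilon>)
    case Plus
    then show ?thesis using assms(2) e by (simp add: balance_def sets)
  next
    case Minus
    then have "card A = 0" "d = 0" using assms(2) by (simp_all add: balance_def sets)
    then show ?thesis by auto
  qed
  then show "card A = d" "\<forall>a \<in> A. finite A \<longrightarrow> \<sigma> a = Some Plus"
    by auto
qed

section \<open>Outputs of the algorithm as admissible and compatible permutations\<close>

context
  fixes p q :: nat and x :: signed_invol and w :: "nat \<Rightarrow> nat"
  assumes qp: "q \<le> p" and x: "x \<in> signed_involutions p q" and w: "w permutes {1..p + q}"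
begin

lemma strand_unsigned:
  assumes "(a, b) \<in> strands (fst x)"
  shows "snd x a = None \<and> snd x b = None"
proof -
  have "fst x a \<noteq> a" "fst x b \<noteq> b"
    using assms by (auto simp: strands_def)
  then show ?thesis
    using signed_involutionsD(3)[OF x] by (metis (mono_tags, lifting) domIff mem_Collect_eq)
qed

lemma fixed_if_signed: "snd x a = Some \<epsilon> \<Longrightarrow> fst x a = a"
  using signed_involutionsD(3)[OF x] by (metis (mono_tags, lifting) domI mem_Collect_eq)

lemma balance_all: "balance (snd x) {1..p + q} = int (p - q)"
proof -
  have "{a \<in> {1..p + q}. snd x a = Some s} = {a. snd x a = Some s}" for s
    using signed_involutionsD(3)[OF x] by blast
  then show ?thesis
    using signed_involutionsD(4)[OF x] qp by (simp add: balance_def)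
qed

lemma alg_set_imp_admissible_compatible:
  assumes "w \<in> alg_set (p + q) x"
  shows "admissible (p + q) q w" "compatible p q x w"
proof -
  let ?n = "p + q" and ?S = "strands (fst x)"
  note D = signed_involutionsD[OF x]
  obtain k A where run: "alg_run ?n ?S (snd x) w k A" and mono: "monochromatic (snd x) A"
    and incr: "strict_mono_on {k + 1..?n - k} w"
    using assms unfolding alg_set_def by blast
  have win: "2 * k \<le> ?n" "A = w ` {k + 1..?n - k}" and steps: "\<forall>j \<in> {1..k}. alg_step ?n ?S (snd x) w j"
    using alg_run_window[OF run w] by (auto simp: strands_def)
  have "finite A" and bal: "balance (snd x) A = int (p - q)"
    using alg_run_balance[OF run] strand_unsigned balance_all by auto
  then have card: "card A = p - q" and plus: "\<forall>a \<in> A. snd x a = Some Plus"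
    using balance_monochromatic[OF mono bal] by auto
  \<comment> \<open>After \<open>k\<close> steps \<open>p + q - 2 * k\<close> positions are left;
    comparison with \<open>p - q\<close> determines \<open>k\<close>.\<close>
  have "card A = ?n - k - k"
    using win(2) permutes_inj[OF w] by (simp add: card_image inj_on_subset)
  then have k: "k = q"
    using card win(1) qp by linarith
  have step: "alg_step ?n ?S (snd x) w j" if "1 \<le> j" "j \<le> q" for j
    using steps k that by simp
  have mem: "w y \<in> w ` {j..?n + 1 - j}" if "j \<le> y" "y \<le> ?n + 1 - j" for y j
    using that by simp
  have strandI: "(w l, w (?n + 1 - l)) \<in> ?S" if "1 \<le> l" "l \<le> q" "w l < w (?n + 1 - l)" for l
    using step[OF that(1,2)] that(3) unfolding alg_step_def by auto
  show "admissible ?n q w"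
    unfolding admissible_def
  proof (intro conjI allI impI notI)
    show "strict_mono_on {q + 1..?n - q} w"
      using incr k by simp
  next
    fix j l assume jl: "1 \<le> j" "j < l" "l \<le> q"
      and c: "w l < w j \<and> w l < w (?n + 1 - j) \<and> w j < w (?n + 1 - l) \<and> w (?n + 1 - j) < w (?n + 1 - l)"
    have "(w l, w (?n + 1 - l)) \<in> ?S"
      using jl c by (intro strandI) auto
    moreover have "w l \<in> w ` {j..?n + 1 - j}" "w (?n + 1 - l) \<in> w ` {j..?n + 1 - j}"
      using jl qp by (intro mem; linarith)+
    \<comment> \<open>The strand at \<open>l\<close> is still present at step \<open>j\<close> and
      encloses the pair at \<open>j\<close> in either orientation, against both rules of
      choice.\<close>
    ultimately have "w j < w (?n + 1 - j) \<longrightarrow> nested_in ?S (w ` {j..?n + 1 - j}) (w j) (w (?n + 1 - j))"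
      "w (?n + 1 - j) < w j \<longrightarrow> nested_in ?S (w ` {j..?n + 1 - j}) (w (?n + 1 - j)) (w j)"
      using c unfolding nested_in_def by blast+
    moreover have "w j < w (?n + 1 - j)" if "(w j, w (?n + 1 - j)) \<in> ?S"
      using that by (simp add: strands_def)
    ultimately show False
      using step[of j] jl unfolding alg_step_def by auto
  next
    fix j y assume j: "1 \<le> j" "j \<le> q" "j < y" "y < ?n + 1 - j" and c: "w (?n + 1 - j) < w y \<and> w y < w j"
    then have "w y \<in> w ` {j..?n + 1 - j}"
      by (intro mem) auto
    moreover have "(w j, w (?n + 1 - j)) \<notin> ?S"
      using c by (auto simp: strands_def)
    ultimately show False
      using step[OF j(1,2)] c unfolding alg_step_def by blast
  qed
  \<comment> \<open>Strands are placed in increasing and isolated pairs in decreasing order, so the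
    order of the two values reveals which choice was made.\<close>
  have level: "w j < w (?n + 1 - j) \<and> fst x (w j) = w (?n + 1 - j) \<and> fst x (w (?n + 1 - j)) = w j \<or>
     w (?n + 1 - j) < w j \<and> fst x (w j) = w j \<and> fst x (w (?n + 1 - j)) = w (?n + 1 - j)
     \<and> snd x (w j) \<noteq> snd x (w (?n + 1 - j))" if "1 \<le> j" "j \<le> q" for j
    using step[OF that] fixed_if_signed unfolding alg_step_def strands_def by auto
  show "compatible p q x w"
    unfolding compatible_def
  proof (intro conjI ballI impI)
    fix j assume j: "j \<in> {1..?n}"
    consider "j \<le> q" | "p < j" | "q < j" "j \<le> p" by linarith
    then show "fst x (w j) = partner ?n q w j"
    proof cases
      case 1
      then have "j \<le> ?n + 1 - j" using qp j by auto
      then show ?thesis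
        using level[of j] 1 j by (auto simp: partner_def min_absorb1 max_absorb2)
    next
      case 2
      then have r: "?n + 1 - j \<le> j" "1 \<le> ?n + 1 - j" "?n + 1 - j \<le> q" "?n + 1 - (?n + 1 - j) = j"
        using qp j by auto
      then show ?thesis
        using level[of "?n + 1 - j"] 2 by (auto simp: partner_def min_absorb2 max_absorb1)
    next
      case 3
      then have "w j \<in> A" using win(2) k by auto
      then show ?thesis
        using plus fixed_if_signed 3 by (simp add: partner_def)
    qed
  next
    fix j assume "j \<in> {1..q}" "fst x (w j) = w j"
    then show "snd x (w j) \<noteq> snd x (w (?n + 1 - j))"
      using level[of j] by auto
  next
    fix j assume "j \<in> {q + 1..p}"
    then show "snd x (w j) = Some Plus"
      using plus win(2) k by auto
  qed
qed

lemma admissible_compatible_imp_alg_set: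
  assumes adm: "admissible (p + q) q w" and comp: "compatible p q x w"
  shows "w \<in> alg_set (p + q) x"
proof -
  let ?n = "p + q" and ?S = "strands (fst x)"
  note D = signed_involutionsD[OF x] and C = compatibleD[OF comp]
  note inj = inj_eq[OF permutes_inj[OF w]]
  have w_in: "w j \<in> {1..?n} \<longleftrightarrow> j \<in> {1..?n}" for j
    by (rule permutes_in_image[OF w])
  have signed: "snd x a \<noteq> None" if "a \<in> {1..?n}" "fst x a = a" for a
    using D(3) that by (metis (mono_tags, lifting) domIff mem_Collect_eq)
  \<comment> \<open>Compatibility puts the two ends of every strand at mirror positions, the smaller
    on the left. A strand of the window other than the pair at \<open>j\<close> is thus the pair of
    a later position, where the enclosure clause applies.\<close>
  have nested: "\<exists>l. j < l \<and> l \<le> q \<and> c = w l \<and> d = w (?n + 1 - l)"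
    if cd: "(c, d) \<in> ?S" "c \<in> w ` {j..?n + 1 - j}" "d \<in> w ` {j..?n + 1 - j}" "1 \<le> j" "j \<le> q"
      and ne: "c \<noteq> w j" "c \<noteq> w (?n + 1 - j)" for c d j
  proof -
    obtain y z where y: "c = w y" "j \<le> y" "y \<le> ?n + 1 - j" and z: "d = w z"
      using cd by auto
    have yn: "1 \<le> y" "y \<le> ?n" using y cd by auto
    have "partner ?n q w y = d" "c < d"
      using C(1)[OF yn] cd(1) y by (auto simp: strands_def)
    then have d: "d = w (?n + 1 - y)" and outer: "y \<le> q \<or> p < y"
      and lt: "w (min y (?n + 1 - y)) < w (max y (?n + 1 - y))"
      using y by (auto simp: partner_def split: if_splits)
    have "y \<le> ?n + 1 - y"
    proof (rule ccontr)
      assume "\<not> y \<le> ?n + 1 - y"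
      then have "w (?n + 1 - y) < w y" using lt by (simp add: min_absorb2 max_absorb1)
      then show False using \<open>c < d\<close> d y by simp
    qed
    then have "y \<le> q" using outer qp by linarith
    moreover have "j < y" using y ne by (cases "j = y") auto
    ultimately show ?thesis using y d by blast
  qed
  \<comment> \<open>\<open>min\<close> and \<open>max\<close> handle strands and reversed pairs of
    isolated vertices together.\<close>
  have no_nest: "\<not> nested_in ?S (w ` {j..?n + 1 - j}) (min (w j) (w (?n + 1 - j))) (max (w j) (w (?n + 1 - j)))"
    if j: "1 \<le> j" "j \<le> q" for j
  proof
    assume "nested_in ?S (w ` {j..?n + 1 - j}) (min (w j) (w (?n + 1 - j))) (max (w j) (w (?n + 1 - j)))"
    then obtain c d where cd: "(c, d) \<in> ?S" "c \<in> w ` {j..?n + 1 - j}" "d \<in> w ` {j..?n + 1 - j}"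
      and o: "c < w j" "c < w (?n + 1 - j)" "w j < d" "w (?n + 1 - j) < d"
      unfolding nested_in_def by auto
    from nested[OF cd j] o obtain l where "j < l" "l \<le> q" "c = w l" "d = w (?n + 1 - l)"
      by auto
    with admissible_nest[OF adm j(1), of l] o show False
      by auto
  qed
  have "k \<le> q \<Longrightarrow> alg_run ?n ?S (snd x) w k (w ` {k + 1..?n - k})" for k
  proof (induction k)
    case 0
    have "w ` {0 + 1..?n - 0} = {1..?n}" using permutes_image[OF w] by simp
    then show ?case using alg_run.start by metis
  next
    case (Suc k)
    let ?A = "w ` {k + 1..?n - k}" and ?a = "w (Suc k)" and ?b = "w (?n + 1 - Suc k)"
    have run: "alg_run ?n ?S (snd x) w k ?A" using Suc by simp
    have j: "1 \<le> Suc k" "Suc k \<le> q" "Suc k < ?n + 1 - Suc k" "?n + 1 - Suc k \<le> ?n"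
      using Suc qp by auto
    have mem: "?a \<in> ?A" "?b \<in> ?A" using j by auto
    have ne: "?a \<noteq> ?b" using j(3) inj by auto
    have window: "?A - {?a, ?b} = w ` {Suc k + 1..?n - Suc k}"
      using image_window_Suc(2)[OF permutes_inj[OF w], of k ?n] mem ne by simp
    have A: "?A = w ` {Suc k..?n + 1 - Suc k}" by simp
    have ps: "fst x ?a = (if ?a < ?b then ?b else ?a)" "fst x ?b = (if ?a < ?b then ?a else ?b)"
    proof -
      have "?n + 1 - (?n + 1 - Suc k) = Suc k" using j by linarith
      moreover have "p < ?n + 1 - Suc k" using j by linarith
      ultimately show "fst x ?a = (if ?a < ?b then ?b else ?a)" "fst x ?b = (if ?a < ?b then ?a else ?b)"
        using C(1)[of "Suc k"] C(1)[of "?n + 1 - Suc k"] j by (simp_all add: partner_def)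
    qed
    have sg: "\<exists>\<epsilon> \<delta>. snd x ?a = Some \<epsilon> \<and> snd x ?b = Some \<delta> \<and> \<epsilon> \<noteq> \<delta>" if "\<not> ?a < ?b"
    proof -
      have "?a \<in> {1..?n}" "?b \<in> {1..?n}"
        unfolding w_in using j by auto
      then have "snd x ?a \<noteq> None" "snd x ?b \<noteq> None"
        using signed[of ?a] signed[of ?b] ps that by simp_all
      moreover have "snd x ?a \<noteq> snd x ?b"
        using C(2)[OF j(1,2)] ps that by simp
      ultimately show ?thesis by auto
    qed
    \<comment> \<open>The algorithm may not stop early: two signed ends would be isolated, hence
      reversed, hence of opposite signs.\<close>
    have nm: "\<not> monochromatic (snd x) ?A"
    proof
      assume "monochromatic (snd x) ?A"
      then obtain \<epsilon> where e: "snd x ?a = Some \<epsilon>" "snd x ?b = Some \<epsilon>"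
        using mem unfolding monochromatic_def by blast
      then have "fst x ?a = ?a" using fixed_if_signed by blast
      then have "\<not> ?a < ?b" using ps ne by (auto split: if_splits)
      then show False using sg e by auto
    qed
    show ?case
    proof (cases "?a < ?b")
      case True
      then have "(?a, ?b) \<in> ?S" using ps by (simp add: strands_def)
      moreover have "\<not> nested_in ?S ?A ?a ?b"
        using no_nest[OF j(1,2)] True unfolding A by simp
      ultimately show ?thesis
        using alg_run.strand[OF run nm _ mem _ refl refl] window by simp
    next
      case False
      then have lt: "?b < ?a" using ne by simp
      obtain \<epsilon> \<delta> where s: "snd x ?b = Some \<delta>" "snd x ?a = Some \<epsilon>" "\<delta> \<noteq> \<epsilon>"
        using sg[OF False] by auto
      have "\<not> nested_in ?S ?A ?b ?a"
        using no_nest[OF j(1,2)] lt unfolding A by simp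
      moreover have "\<not> (\<exists>y \<in> ?A. ?b < y \<and> y < ?a)"
      proof
        assume "\<exists>y \<in> ?A. ?b < y \<and> y < ?a"
        then obtain y where y: "Suc k \<le> y" "y \<le> ?n + 1 - Suc k" "?b < w y" "w y < ?a"
          unfolding A by auto
        then have "y \<noteq> Suc k" "y \<noteq> ?n + 1 - Suc k" by auto
        with y admissible_adj[OF adm j(1,2), of y] show False by linarith
      qed
      ultimately have "alg_run ?n ?S (snd x) w (Suc k) (?A - {?b, ?a})"
        using alg_run.isolated[OF run nm mem(2,1) lt s _ _ refl refl] by simp
      then show ?thesis
        using window by (simp add: insert_commute)
    qed
  qed
  from this[of q] have "alg_run ?n ?S (snd x) w q (w ` {q + 1..?n - q})" by simp
  moreover have "monochromatic (snd x) (w ` {q + 1..?n - q})"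
    using C(3) unfolding monochromatic_def by auto
  moreover have "strict_mono_on {q + 1..?n - q} w"
    using adm by (simp add: admissible_def)
  ultimately show ?thesis
    using w unfolding alg_set_def by blast
qed

end

section \<open>Saturated chains\<close>

lemma saturated_chain_Nil: "saturated_chain p q [] x y \<longleftrightarrow> x = y \<and> x \<in> signed_involutions p q"
  unfolding saturated_chain_def by (auto intro: exI[of _ "\<lambda>_. x"])

lemma saturated_chain_snoc:
  "saturated_chain p q (is @ [i]) x y \<longleftrightarrow>
    (\<exists>z. saturated_chain p q is x z \<and> y \<in> signed_involutions p q \<and>
      cover i (matching_of z) (matching_of y))"
proof
  assume "saturated_chain p q (is @ [i]) x y"
  then obtain c where c: "c 0 = x" "c (Suc (length is)) = y"
    "\<And>j. j \<le> Suc (length is) \<Longrightarrow> c j \<in> signed_involutions p q"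
    "\<And>j. j < Suc (length is) \<Longrightarrow> cover ((is @ [i]) ! j) (matching_of (c j)) (matching_of (c (Suc j)))"
    unfolding saturated_chain_def by auto
  have "cover (is ! j) (matching_of (c j)) (matching_of (c (Suc j)))" if "j < length is" for j
    using c(4)[of j] that by (simp add: nth_append)
  then have "saturated_chain p q is x (c (length is))"
    unfolding saturated_chain_def using c by (intro exI[of _ c]) auto
  moreover have "cover i (matching_of (c (length is))) (matching_of y)"
    using c(4)[of "length is"] c(2) by simp
  ultimately show "\<exists>z. saturated_chain p q is x z \<and> y \<in> signed_involutions p q \<and>
      cover i (matching_of z) (matching_of y)"
    using c(2,3) by blast
next
  assume "\<exists>z. saturated_chain p q is x z \<and> y \<in> signed_involutions p q \<and>
      cover i (matching_of z) (matching_of y)"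
  then obtain z c where c: "c 0 = x" "c (length is) = z"
    "\<And>j. j \<le> length is \<Longrightarrow> c j \<in> signed_involutions p q"
    "\<And>j. j < length is \<Longrightarrow> cover (is ! j) (matching_of (c j)) (matching_of (c (Suc j)))"
    and y: "y \<in> signed_involutions p q" "cover i (matching_of z) (matching_of y)"
    unfolding saturated_chain_def by auto
  show "saturated_chain p q (is @ [i]) x y"
    unfolding saturated_chain_def
  proof (intro exI[of _ "c(Suc (length is) := y)"] conjI allI impI)
    fix j assume "j < length (is @ [i])"
    then show "cover ((is @ [i]) ! j) (matching_of ((c(Suc (length is) := y)) j))
        (matching_of ((c(Suc (length is) := y)) (Suc j)))"
      using c y by (cases "j = length is") (simp_all add: nth_append)
  qed (use c y in \<open>auto simp: le_Suc_eq\<close>)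
qed

lemma saturated_chain_target:
  "saturated_chain p q is x y \<Longrightarrow> y \<in> signed_involutions p q"
  unfolding saturated_chain_def by auto

lemma L_pm_saturated_chain:
  assumes "saturated_chain p q is x y" "set is \<subseteq> {1..p + q - 1}"
  shows "L_pm p q y = L_pm p q x + of_nat (length is)"
  using assms
proof (induction "is" arbitrary: y rule: rev_induct)
  case Nil
  then show ?case by (simp add: saturated_chain_Nil)
next
  case (snoc i "is")
  then obtain z where z: "saturated_chain p q is x z" "y \<in> signed_involutions p q"
    "cover i (matching_of z) (matching_of y)"
    unfolding saturated_chain_snoc by blast
  have "i \<in> {1..p + q - 1}" "set is \<subseteq> {1..p + q - 1}"
    using snoc.prems by auto
  then have "L_pm p q y = L_pm p q z + 1" "L_pm p q z = L_pm p q x + of_nat (length is)"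
    using L_pm_cover[OF saturated_chain_target[OF z(1)] z(2) _ z(3)] snoc.IH[OF z(1)] by simp_all
  then show ?case by simp
qed

section \<open>The base case: the identity and the minimal element\<close>

lemma partner_id:
  assumes "q \<le> p" "1 \<le> j" "j \<le> p + q"
  shows "partner (p + q) q id j = fst (min_elt p q) j"
  using assms by (auto simp: partner_def fst_min_elt min_def max_def)

lemma admissible_id:
  assumes "q \<le> p"
  shows "admissible (p + q) q id"
  using assms unfolding admissible_def by (auto simp: strict_mono_on_def)

lemma compatible_id:
  assumes "q \<le> p"
  shows "compatible p q (min_elt p q) id"
  unfolding compatible_def using partner_id[OF assms] assms
  by (auto simp: fst_min_elt snd_min_elt)

text \<open>For the identity all outer pairs increase and are strands, so there is no choice of
  signs left and compatibility determines \<open>x\<close>.\<close>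

lemma compatible_id_imp_min_elt:
  assumes "q \<le> p" and x: "x \<in> signed_involutions p q" and comp: "compatible p q x id"
  shows "x = min_elt p q"
proof (rule prod_eqI)
  note D = signed_involutionsD[OF x] and D' = signed_involutionsD[OF min_elt_in_signed_involutions[OF assms(1)]]
  note C = compatibleD[OF comp]
  show fst: "fst x = fst (min_elt p q)"
  proof
    fix j
    show "fst x j = fst (min_elt p q) j"
    proof (cases "j \<in> {1..p + q}")
      case True
      then show ?thesis using C(1)[of j] partner_id[OF assms(1), of j] by simp
    next
      case False
      then show ?thesis using permutes_not_in[OF D(1)] permutes_not_in[OF D'(1)] by metis
    qed
  qed
  have "dom (snd x) = dom (snd (min_elt p q))"
    using D(3) D'(3) fst by simp
  moreover have "dom (snd (min_elt p q)) = {q<..p}"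
    by (auto simp: dom_def snd_min_elt)
  ultimately have "snd x j = None" if "j \<notin> {q<..p}" for j
    using that by blast
  then show "snd x = snd (min_elt p q)"
    using C(3) by (auto simp: fun_eq_iff snd_min_elt)
qed

text \<open>The hypothesis on inversions says that the word is reduced. It makes every prefix
  reduced and every new letter lengthening, so \<open>i\<close> always stands to the left of
  \<open>Suc i\<close> when its letter is applied.\<close>

lemma saturated_chain_imp_admissible_compatible:
  assumes "q \<le> p" "set is \<subseteq> {1..p + q - 1}" "saturated_chain p q is (min_elt p q) x"
    "card (inversions (word_perm is)) = length is"
  shows "admissible (p + q) q (word_perm is) \<and> compatible p q x (word_perm is)"
  using assms(2-)
proof (induction "is" arbitrary: x rule: rev_induct)
  case Nil
  then have "x = min_elt p q" by (simp add: saturated_chain_Nil)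
  then show ?case
    unfolding word_perm_Nil using admissible_id[OF assms(1)] compatible_id[OF assms(1)] by blast
next
  case (snoc i "is")
  then have i: "i \<in> {1..p + q - 1}" and sub: "set is \<subseteq> {1..p + q - 1}" by auto
  from snoc.prems obtain z where z: "saturated_chain p q is (min_elt p q) z"
    "x \<in> signed_involutions p q" "cover i (matching_of z) (matching_of x)"
    unfolding saturated_chain_snoc by blast
  let ?w = "word_perm is"
  have w: "?w permutes {1..p + q}"
    using sub by (rule word_perm_permutes)
  have le: "card (inversions ?w) \<le> length is"
    using sub by (rule card_inversions_word_perm_le)
  have len: "card (inversions (transpose i (Suc i) \<circ> ?w)) = Suc (length is)"
    using snoc.prems(3) by (simp del: comp_apply add: word_perm_snoc)
  from w i obtain u v where uv: "u \<in> {1..p + q}" "v \<in> {1..p + q}" "u < v" "?w u = i" "?w v = Suc i"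
  proof (cases rule: permutes_descent_cases)
    case (down u v)
    then show thesis using card_inversions_down[OF w i down(3-5)] len le by simp
  qed
  have "card (inversions ?w) = length is"
    using card_inversions_up[OF w uv(3-5)] len by simp
  then have IH: "admissible (p + q) q ?w" "compatible p q z ?w"
    using snoc.IH[OF sub z(1)] by auto
  have uv': "1 \<le> u" "u < v" "v \<le> p + q" using uv by auto
  note up = compatible_up[OF assms(1) i w uv' uv(4,5) saturated_chain_target[OF z(1)] z(2,3) IH(2)]
  have "admissible (p + q) q (transpose i (Suc i) \<circ> ?w)"
    using descent_imp_admissible_transpose[OF _ uv' permutes_inj[OF w] uv(4,5) IH(1) up(2)] assms(1)
    by simp
  with up(1) show ?case
    unfolding word_perm_snoc by blast
qed

text \<open>The chain is built from the top: any descent of \<open>w\<close> can be its last letter,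
  and the element below, found by undoing the cover, is compatible with the shorter
  permutation.\<close>

lemma admissible_compatible_imp_saturated_chain:
  assumes "q \<le> p" "x \<in> signed_involutions p q" "w permutes {1..p + q}"
    "admissible (p + q) q w" "compatible p q x w"
  shows "\<exists>is. set is \<subseteq> {1..p + q - 1} \<and> word_perm is = w \<and> length is = card (inversions w) \<and>
    saturated_chain p q is (min_elt p q) x"
  using assms(2-)
proof (induction "card (inversions w)" arbitrary: w x rule: less_induct)
  case less
  show ?case
  proof (cases "w = id")
    case True
    then have "x = min_elt p q"
      using compatible_id_imp_min_elt[OF assms(1) less.prems(1)] less.prems(4) by blast
    then show ?thesis
      using True less.prems(1) by (intro exI[of _ "[]"]) (simp add: saturated_chain_Nil)
  next
    case False
    with less.prems(2) obtain i u v where i: "i \<in> {1..p + q - 1}" and uv: "u < v" "w v = i" "w u = Suc i"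
      using permutes_ex_descent by blast
    let ?w = "transpose i (Suc i) \<circ> w"
    have w: "?w permutes {1..p + q}"
      using permutes_transpose_comp[OF less.prems(2) i] .
    have uv': "?w u = i" "?w v = Suc i"
      using uv by simp_all
    have "w u \<in> {1..p + q}" "w v \<in> {1..p + q}"
      using uv i by auto
    then have "u \<in> {1..p + q}" "v \<in> {1..p + q}"
      by (simp_all only: permutes_in_image[OF less.prems(2)])
    with uv have bounds: "1 \<le> u" "u < v" "v \<le> p + q"
      by simp_all
    \<comment> \<open>The transfer lemmas lead from a permutation to its product with the
      transposition; started at \<open>?w\<close>, that product is \<open>w\<close> again.\<close>
    have ww: "transpose i (Suc i) \<circ> ?w = w"
      by (rule transpose_comp_transpose_comp)
    have qn: "2 * q \<le> p + q"
      using assms(1) by simp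
    note core = admissible_transpose_imp_admissible[OF qn bounds permutes_inj[OF w] uv', unfolded ww]
      admissible_transpose_imp_descent[OF qn bounds permutes_inj[OF w] uv', unfolded ww]
    note adm = core(1)[OF less.prems(3)] and desc = core(2)[OF less.prems(3)]
    obtain x' where x': "x' \<in> signed_involutions p q" "cover i (matching_of x') (matching_of x)"
      "compatible p q x' ?w"
      using compatible_down[OF assms(1) i w bounds uv' less.prems(1) _ desc, unfolded ww, OF less.prems(4)]
      by blast
    have c: "card (inversions w) = Suc (card (inversions ?w))"
      using card_inversions_down[OF less.prems(2) i uv] .
    then obtain "is" where word: "set is \<subseteq> {1..p + q - 1}" "word_perm is = ?w"
      "length is = card (inversions ?w)" and chain: "saturated_chain p q is (min_elt p q) x'"
      using less.hyps[OF _ x'(1) w adm x'(3)] by auto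
    have "saturated_chain p q (is @ [i]) (min_elt p q) x"
      unfolding saturated_chain_snoc using chain less.prems(1) x'(2) by blast
    moreover have "word_perm (is @ [i]) = w"
      unfolding word_perm_snoc word(2) by (rule ww)
    ultimately show ?thesis
      using c i word(1,3) by (intro exI[of _ "is @ [i]"]) simp
  qed
qed

theorem theorem2p19:
  fixes p q n :: nat and x :: signed_invol
  assumes "p \<ge> q" and "q > 0" and "p + q = n"
    and "x \<in> signed_involutions p q"
  shows "W_set p q x = alg_set n x"
proof (rule set_eqI)
  fix w
  show "w \<in> W_set p q x \<longleftrightarrow> w \<in> alg_set n x"
  proof
    assume "w \<in> W_set p q x"
    then obtain "is" where w: "w permutes {1..p + q}" and "reduced_word (p + q) is w"
      and chain: "saturated_chain p q is (min_elt p q) x"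
      unfolding W_set_def by blast
    then have "set is \<subseteq> {1..p + q - 1}" "word_perm is = w" "card (inversions w) = length is"
      by (auto simp: reduced_word_def coxeter_length_eq_card_inversions[OF w])
    then have "admissible (p + q) q w \<and> compatible p q x w"
      using saturated_chain_imp_admissible_compatible[OF assms(1) _ chain] by blast
    then show "w \<in> alg_set n x"
      using admissible_compatible_imp_alg_set[OF assms(1,4) w] assms(3) by blast
  next
    assume mem: "w \<in> alg_set n x"
    then have w: "w permutes {1..p + q}"
      using assms(3) by (simp add: alg_set_def)
    note ac = alg_set_imp_admissible_compatible[OF assms(1,4) w mem[folded assms(3)]]
    obtain "is" where chain: "set is \<subseteq> {1..p + q - 1}" "word_perm is = w"
      "length is = card (inversions w)" "saturated_chain p q is (min_elt p q) x"
      using admissible_compatible_imp_saturated_chain[OF assms(1,4) w ac] by blast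
    then have "reduced_word (p + q) is w"
      by (simp add: reduced_word_def coxeter_length_eq_card_inversions[OF w])
    moreover have "of_nat (coxeter_length (p + q) w) = L_pm p q x"
      using L_pm_saturated_chain[OF chain(4,1)] L_pm_min_elt[OF assms(1)] chain(3)
      by (simp add: coxeter_length_eq_card_inversions[OF w])
    ultimately show "w \<in> W_set p q x"
      using w chain(4) unfolding W_set_def by blast
  qed
qed

end
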